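(* Let $p\ge 3$ be an integer, $t=2p-2$, $G=(V,E)$ a simple undirected graph in which every vertex has degree at least $1$ and at most $t+1$, and $w:E\to\mathbb{R}_{\ge 0}$ a weight function vertex-induced on every $K^p_2$ of $G$. Let $G'=(V',E')$, $w'$, $l$, $b$ be as constructed below. If $M'$ is a minimum weight $(l,b)$-matching of $G'$, then there exists a $K^p_2$-covering co-$t$-matching $\bar M$ of $G$ with $w(\bar M)\le w'(M')$.
   Context: $K^p_2$ is the complete $p$-partite graph with $p$ color classes of $2$ vertices each; a "$K^p_2$ of $G$" is a subgraph of $G$ (not necessarily induced) isomorphic to it; two such are different if they are different subgraphs (they may share the vertex set). $w$ is vertex-induced on a subgraph $H$ if there is $r_H:V(H)\to\mathbb{R}$ (a potential function) with $w(u,v)=r_H(u)+r_H(v)$ for every edge of $H$; $w(H)$ is the total edge weight of $H$. $\bar M\subseteq E$ is a co-$t$-matching if $E\setminus\bar M$ is a $t$-matching; it is $K^p_2$-covering if moreover $E\setminus\bar M$ contains the edge set of no $K^p_2$ of $G$. A $K^p_2$ $H$ is unproblematic if some other $K^p_2$ $H'$ of $G$ shares a vertex with $H$ and $w(H)\le w(H')$, and problematic otherwise. For $A\subseteq V$ with $|A|=2p$, $G[A]$ is dense if it contains at least two different $K^p_2$'s; its core is $C_{G[A]}=\{a\in A:\ \text{all neighbours of } a \text{ lie in } A,\ \deg_G(a)=t+1\}$. For a dense $H$, $w$ is vertex-induced on $H$ with potential function $r_H$ (that of any $K^p_2$ contained in $H$); let $|C_H|=2k$ and let $V_1,\dots,V_{p-k}$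 be the color classes of a $K^p_2$ contained in $H$ that are not subsets of $C_H$ (these are the same for every $K^p_2$ in $H$); the center $c_H$ is a vertex of $C_H$ of minimum potential $r_H$. Construction: start with $G'=G$, $w'=w$ on $E$, and capacity interval $[l(v),b(v)]=[1,t+1]$ if $\deg_G(v)=t+1$, $[0,\deg_G(v)]$ otherwise, for $v\in V$. For each problematic $K^p_2$ $H$ with color classes $V_1(H),\dots,V_p(H)$ and potential $r_H$, add vertices $u^1_H,\dots,u^p_H$ (interval $[1,1]$), $z_H$ (interval $[p-2,p-2]$), edges $(v,u^i_H)$ of weight $r_H(v)$ for $v\in V_i(H)$ and edges $(u^i_H,z_H)$ of weight $0$. For each dense subgraph $H$ with $r_H(c_H)\ge 0$ add vertices $u^c_H,u^1_H,\dots,u^{p-k}_H,z_H$; edges $(v,u^i_H)$ of weight $r_H(v)$ for $v\in V_i$ and $(u^i_H,z_H)$ of weight $0$; two parallel edges $(c_H,u^c_H)$ each of weight $r_H(c_H)$ and two parallel edges $(u^c_H,z_H)$ of weight $0$; capacity intervals $[p-k,p-k]$ for $z_H$, $[2,2]$ for $u^c_H$, $[1,1]$ for $u^i_H$. Dense subgraphs with $r_H(c_H)<0$ get nothing. An $(l,b)$-matching of the multigraph $G'$ is a set $M'\subseteq E'$ with $l(v)\le\deg_{M'}(v)\le b(v)$ for all $v\in V'$; it is minimum weight if its total weight $w'(M')$ is minimum among all $(l,b)$-matchings. *)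

theory Defs
  imports Complex_Main "HOL-Library.Disjoint_Sets"
begin

subsection \<open>Simple graphs\<close>

datatype 'a graph = Graph (verts: "'a set") (edges: "'a set set")

definition simple_graph :: "'a graph \<Rightarrow> bool" where
  "simple_graph G \<longleftrightarrow> finite (verts G) \<and> (\<forall>e\<in>edges G. e \<subseteq> verts G \<and> card e = 2)"

definition neighbours :: "'a graph \<Rightarrow> 'a \<Rightarrow> 'a set" where
  "neighbours G v = {u. {u, v} \<in> edges G}"

definition deg_in :: "'a set set \<Rightarrow> 'a \<Rightarrow> nat" where
  "deg_in F v = card {e \<in> F. v \<in> e}"

abbreviation degree :: "'a graph \<Rightarrow> 'a \<Rightarrow> nat" where
  "degree G \<equiv> deg_in (edges G)"

definition subgraph :: "'a graph \<Rightarrow> 'a graph \<Rightarrow> bool" where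
  "subgraph H G \<longleftrightarrow> verts H \<subseteq> verts G \<and> edges H \<subseteq> edges G"

definition induced :: "'a graph \<Rightarrow> 'a set \<Rightarrow> 'a graph" where
  "induced G A = Graph A {e \<in> edges G. e \<subseteq> A}"

subsection \<open>Complete multipartite graphs with colour classes of size two\<close>

definition Kp2_classes :: "nat \<Rightarrow> 'a graph \<Rightarrow> 'a set set \<Rightarrow> bool" where
  "Kp2_classes p H P \<longleftrightarrow>
     partition_on (verts H) P \<and> finite P \<and> card P = p \<and> (\<forall>X\<in>P. card X = 2) \<and>
     edges H = {{u, v} | u v X Y. X \<in> P \<and> Y \<in> P \<and> X \<noteq> Y \<and> u \<in> X \<and> v \<in> Y}"

definition is_Kp2 :: "nat \<Rightarrow> 'a graph \<Rightarrow> bool" where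
  "is_Kp2 p H \<longleftrightarrow> (\<exists>P. Kp2_classes p H P)"

definition Kp2s :: "nat \<Rightarrow> 'a graph \<Rightarrow> 'a graph set" where
  "Kp2s p G = {H. subgraph H G \<and> is_Kp2 p H}"

definition colour_classes :: "nat \<Rightarrow> 'a graph \<Rightarrow> 'a set set" where
  "colour_classes p H = (THE P. Kp2_classes p H P)"

lemma Kp2_classes_eq:
  assumes "Kp2_classes p H P"
  shows "P = {{x, y} | x y. x \<in> verts H \<and> y \<in> verts H \<and> x \<noteq> y \<and> {x, y} \<notin> edges H}"
proof -
  have part: "\<Union>P = verts H" "\<And>X Y. X \<in> P \<Longrightarrow> Y \<in> P \<Longrightarrow> X \<noteq> Y \<Longrightarrow> X \<inter> Y = {}"
    and two: "\<And>X. X \<in> P \<Longrightarrow> card X = 2"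
    and E: "edges H = {{u, v} | u v X Y. X \<in> P \<and> Y \<in> P \<and> X \<noteq> Y \<and> u \<in> X \<and> v \<in> Y}"
    using assms by (auto simp: Kp2_classes_def partition_on_def disjoint_def)
  have non_edge: "{x, y} \<notin> edges H" if "X \<in> P" "x \<in> X" "y \<in> X" for X x y
    using that part(2) unfolding E by (auto simp: doubleton_eq_iff) (metis disjoint_iff)+
  show ?thesis
  proof (intro equalityI subsetI)
    fix X assume X: "X \<in> P"
    then obtain x y where xy: "X = {x, y}" "x \<noteq> y" using two by (metis card_2_iff)
    then have "x \<in> verts H" "y \<in> verts H" using X part(1) by auto
    then show "X \<in> {{x, y} | x y. x \<in> verts H \<and> y \<in> verts H \<and> x \<noteq> y \<and> {x, y} \<notin> edges H}"
      using xy non_edge[OF X] by blast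
  next
    fix Z assume "Z \<in> {{x, y} | x y. x \<in> verts H \<and> y \<in> verts H \<and> x \<noteq> y \<and> {x, y} \<notin> edges H}"
    then obtain x y where Z: "Z = {x, y}" "x \<in> verts H" "y \<in> verts H" "x \<noteq> y" "{x, y} \<notin> edges H"
      by blast
    then obtain X Y where "X \<in> P" "x \<in> X" "Y \<in> P" "y \<in> Y"
      using part(1) by (metis UnionE)
    moreover from this have "X = Y" using Z(5) unfolding E by blast
    ultimately have "X \<in> P" "{x, y} \<subseteq> X" "card X = 2" using two by auto
    then have "X = {x, y}"
      using Z(4) by (metis card_2_iff card_subset_eq card.infinite zero_neq_numeral)
    then show "Z \<in> P" using \<open>X \<in> P\<close> Z(1) by simp
  qed
qed

lemma colour_classes_eqI: "Kp2_classes p H P \<Longrightarrow> colour_classes p H = P"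
  unfolding colour_classes_def by (rule the_equality) (auto dest: Kp2_classes_eq)

subsection \<open>Vertex-induced weights\<close>

definition potential_function :: "('a set \<Rightarrow> real) \<Rightarrow> 'a graph \<Rightarrow> ('a \<Rightarrow> real) \<Rightarrow> bool" where
  "potential_function w H r \<longleftrightarrow> (\<forall>u v. {u, v} \<in> edges H \<longrightarrow> w {u, v} = r u + r v)"

definition vertex_induced :: "('a set \<Rightarrow> real) \<Rightarrow> 'a graph \<Rightarrow> bool" where
  "vertex_induced w H \<longleftrightarrow> (\<exists>r. potential_function w H r)"

(* For p >= 3 the choice does not matter: two potential functions of a graph on A that contains
   a K^p_2 with vertex set A agree on A (potential_function_unique). *)
definition pot :: "('a set \<Rightarrow> real) \<Rightarrow> 'a graph \<Rightarrow> 'a \<Rightarrow> real" where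
  "pot w H = (SOME r. potential_function w H r)"

lemma potential_function_unique:
  assumes "p \<ge> 3" "K \<in> Kp2s p H" "verts K = verts H"
    and "potential_function w H r" "potential_function w H s" "v \<in> verts H"
  shows "r v = s v"
proof -
  obtain P where P: "Kp2_classes p K P" using assms(2) by (auto simp: Kp2s_def is_Kp2_def)
  then have fin: "finite P" "card P = p"
    and U: "\<Union>P = verts H" and ne: "\<And>X. X \<in> P \<Longrightarrow> X \<noteq> {}"
    and E: "edges K = {{u, v} | u v X Y. X \<in> P \<and> Y \<in> P \<and> X \<noteq> Y \<and> u \<in> X \<and> v \<in> Y}"
    using assms(3) by (auto simp: Kp2_classes_def partition_on_def)
  have eq: "r u + r v = s u + s v" if "X \<in> P" "Y \<in> P" "X \<noteq> Y" "u \<in> X" "v \<in> Y" for u v X Y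
  proof -
    have "{u, v} \<in> edges K" using that unfolding E by blast
    then have "{u, v} \<in> edges H" using assms(2) by (auto simp: Kp2s_def subgraph_def)
    then show ?thesis using assms(4,5) unfolding potential_function_def by metis
  qed
  obtain X where X: "X \<in> P" "v \<in> X" using assms(6) U by auto
  have "card (P - {X}) \<ge> 2" using fin X assms(1) by simp
  then obtain Q where "Q \<subseteq> P - {X}" "card Q = 2" by (meson obtain_subset_with_card_n)
  then obtain Y Z where YZ: "Y \<in> P" "Z \<in> P" "Y \<noteq> X" "Z \<noteq> X" "Y \<noteq> Z"
    by (auto simp: card_2_iff)
  obtain y z where "y \<in> Y" "z \<in> Z" using ne YZ by blast
  then show ?thesis
    using eq[of X Y v y] eq[of X Z v z] eq[of Y Z y z] X YZ by auto
qed

subsection \<open>Covering co-matchings\<close>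

definition t_matching :: "nat \<Rightarrow> 'a graph \<Rightarrow> 'a set set \<Rightarrow> bool" where
  "t_matching t G M \<longleftrightarrow> M \<subseteq> edges G \<and> (\<forall>v\<in>verts G. deg_in M v \<le> t)"

definition co_t_matching :: "nat \<Rightarrow> 'a graph \<Rightarrow> 'a set set \<Rightarrow> bool" where
  "co_t_matching t G N \<longleftrightarrow> N \<subseteq> edges G \<and> t_matching t G (edges G - N)"

definition Kp2_covering_co_t_matching :: "nat \<Rightarrow> nat \<Rightarrow> 'a graph \<Rightarrow> 'a set set \<Rightarrow> bool" where
  "Kp2_covering_co_t_matching p t G N \<longleftrightarrow>
     co_t_matching t G N \<and> (\<forall>H\<in>Kp2s p G. \<not> edges H \<subseteq> edges G - N)"

subsection \<open>Problematic and dense subgraphs\<close>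

definition unproblematic :: "nat \<Rightarrow> ('a set \<Rightarrow> real) \<Rightarrow> 'a graph \<Rightarrow> 'a graph \<Rightarrow> bool" where
  "unproblematic p w G H \<longleftrightarrow>
     (\<exists>H'\<in>Kp2s p G. H' \<noteq> H \<and> verts H \<inter> verts H' \<noteq> {} \<and> sum w (edges H) \<le> sum w (edges H'))"

definition problematic_Kp2s :: "nat \<Rightarrow> ('a set \<Rightarrow> real) \<Rightarrow> 'a graph \<Rightarrow> 'a graph set" where
  "problematic_Kp2s p w G = {H \<in> Kp2s p G. \<not> unproblematic p w G H}"

definition dense_set :: "nat \<Rightarrow> 'a graph \<Rightarrow> 'a set \<Rightarrow> bool" where
  "dense_set p G A \<longleftrightarrow> A \<subseteq> verts G \<and> card A = 2 * p \<and>
     (\<exists>H\<in>Kp2s p (induced G A). \<exists>H'\<in>Kp2s p (induced G A). H \<noteq> H')"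

definition core :: "nat \<Rightarrow> 'a graph \<Rightarrow> 'a set \<Rightarrow> 'a set" where
  "core t G A = {a \<in> A. neighbours G a \<subseteq> A \<and> degree G a = t + 1}"

(* The union over all K^p_2's of G[A] is harmless: their colour classes outside the core coincide. *)
definition outer_classes :: "nat \<Rightarrow> nat \<Rightarrow> 'a graph \<Rightarrow> 'a set \<Rightarrow> 'a set set" where
  "outer_classes p t G A =
     {X. \<exists>H\<in>Kp2s p (induced G A). X \<in> colour_classes p H \<and> \<not> X \<subseteq> core t G A}"

definition is_center :: "nat \<Rightarrow> ('a set \<Rightarrow> real) \<Rightarrow> 'a graph \<Rightarrow> 'a set \<Rightarrow> 'a \<Rightarrow> bool" where
  "is_center t w G A c \<longleftrightarrow> c \<in> core t G A \<and>
     (\<forall>a\<in>core t G A. pot w (induced G A) c \<le> pot w (induced G A) a)"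

(* Ties for the minimum potential are possible, so the centers are given by a function c
   on the vertex sets of dense subgraphs. *)
definition center_choice ::
    "nat \<Rightarrow> nat \<Rightarrow> ('a set \<Rightarrow> real) \<Rightarrow> 'a graph \<Rightarrow> ('a set \<Rightarrow> 'a) \<Rightarrow> bool" where
  "center_choice p t w G c \<longleftrightarrow> (\<forall>A. dense_set p G A \<longrightarrow> is_center t w G A (c A))"

definition nonneg_dense_sets ::
    "nat \<Rightarrow> ('a set \<Rightarrow> real) \<Rightarrow> 'a graph \<Rightarrow> ('a set \<Rightarrow> 'a) \<Rightarrow> 'a set set" where
  "nonneg_dense_sets p w G c = {A. dense_set p G A \<and> pot w (induced G A) (c A) \<ge> 0}"

subsection \<open>Multigraphs and matchings with degree bounds\<close>

(* Edges are names; the end points of an edge form a two-element set. *)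
record ('v, 'e) multigraph =
  mverts :: "'v set"
  medges :: "'e set"
  mends :: "'e \<Rightarrow> 'v set"

definition lb_matching ::
    "('v, 'e) multigraph \<Rightarrow> ('v \<Rightarrow> nat) \<Rightarrow> ('v \<Rightarrow> nat) \<Rightarrow> 'e set \<Rightarrow> bool" where
  "lb_matching X l b M \<longleftrightarrow> M \<subseteq> medges X \<and>
     (\<forall>x\<in>mverts X. l x \<le> card {e \<in> M. x \<in> mends X e} \<and> card {e \<in> M. x \<in> mends X e} \<le> b x)"

definition min_weight_lb_matching ::
    "('v, 'e) multigraph \<Rightarrow> ('e \<Rightarrow> real) \<Rightarrow> ('v \<Rightarrow> nat) \<Rightarrow> ('v \<Rightarrow> nat) \<Rightarrow> 'e set \<Rightarrow> bool" where
  "min_weight_lb_matching X w l b M \<longleftrightarrow>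
     lb_matching X l b M \<and> (\<forall>N. lb_matching X l b N \<longrightarrow> sum w M \<le> sum w N)"

subsection \<open>The auxiliary multigraph\<close>

(* ProbU H X and DenseU A X are the vertices u^i attached to the i-th class X,
   DenseC A is u^c, and ProbZ H, DenseZ A are the vertices z.
   Gadgets of dense subgraphs are indexed by the vertex set A of the subgraph G[A]. *)
datatype 'a xvert =
    Orig 'a
  | ProbU "'a graph" "'a set"
  | ProbZ "'a graph"
  | DenseU "'a set" "'a set"
  | DenseC "'a set"
  | DenseZ "'a set"

(* The Boolean argument distinguishes two parallel edges. *)
datatype 'a xedge =
    OrigE "'a set"
  | ProbVU "'a graph" "'a set" 'a
  | ProbUZ "'a graph" "'a set"
  | DenseVU "'a set" "'a set" 'a
  | DenseUZ "'a set" "'a set"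
  | CenterC "'a set" bool
  | DenseCZ "'a set" bool

definition xverts ::
    "nat \<Rightarrow> nat \<Rightarrow> ('a set \<Rightarrow> real) \<Rightarrow> 'a graph \<Rightarrow> ('a set \<Rightarrow> 'a) \<Rightarrow> 'a xvert set" where
  "xverts p t w G c =
     Orig ` verts G
     \<union> {ProbU H X | H X. H \<in> problematic_Kp2s p w G \<and> X \<in> colour_classes p H}
     \<union> ProbZ ` problematic_Kp2s p w G
     \<union> {DenseU A X | A X. A \<in> nonneg_dense_sets p w G c \<and> X \<in> outer_classes p t G A}
     \<union> DenseC ` nonneg_dense_sets p w G c
     \<union> DenseZ ` nonneg_dense_sets p w G c"

definition xedges ::
    "nat \<Rightarrow> nat \<Rightarrow> ('a set \<Rightarrow> real) \<Rightarrow> 'a graph \<Rightarrow> ('a set \<Rightarrow> 'a) \<Rightarrow> 'a xedge set" where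
  "xedges p t w G c =
     OrigE ` edges G
     \<union> {ProbVU H X v | H X v. H \<in> problematic_Kp2s p w G \<and> X \<in> colour_classes p H \<and> v \<in> X}
     \<union> {ProbUZ H X | H X. H \<in> problematic_Kp2s p w G \<and> X \<in> colour_classes p H}
     \<union> {DenseVU A X v | A X v. A \<in> nonneg_dense_sets p w G c \<and> X \<in> outer_classes p t G A \<and> v \<in> X}
     \<union> {DenseUZ A X | A X. A \<in> nonneg_dense_sets p w G c \<and> X \<in> outer_classes p t G A}
     \<union> {CenterC A i | A i. A \<in> nonneg_dense_sets p w G c}
     \<union> {DenseCZ A i | A i. A \<in> nonneg_dense_sets p w G c}"

fun xends :: "('a set \<Rightarrow> 'a) \<Rightarrow> 'a xedge \<Rightarrow> 'a xvert set" where
  "xends c (OrigE e) = Orig ` e"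
| "xends c (ProbVU H X v) = {Orig v, ProbU H X}"
| "xends c (ProbUZ H X) = {ProbU H X, ProbZ H}"
| "xends c (DenseVU A X v) = {Orig v, DenseU A X}"
| "xends c (DenseUZ A X) = {DenseU A X, DenseZ A}"
| "xends c (CenterC A i) = {Orig (c A), DenseC A}"
| "xends c (DenseCZ A i) = {DenseC A, DenseZ A}"

definition xgraph ::
    "nat \<Rightarrow> nat \<Rightarrow> ('a set \<Rightarrow> real) \<Rightarrow> 'a graph \<Rightarrow> ('a set \<Rightarrow> 'a)
      \<Rightarrow> ('a xvert, 'a xedge) multigraph" where
  "xgraph p t w G c =
     \<lparr>mverts = xverts p t w G c, medges = xedges p t w G c, mends = xends c\<rparr>"

fun xweight :: "('a set \<Rightarrow> real) \<Rightarrow> 'a graph \<Rightarrow> ('a set \<Rightarrow> 'a) \<Rightarrow> 'a xedge \<Rightarrow> real" where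
  "xweight w G c (OrigE e) = w e"
| "xweight w G c (ProbVU H X v) = pot w H v"
| "xweight w G c (ProbUZ H X) = 0"
| "xweight w G c (DenseVU A X v) = pot w (induced G A) v"
| "xweight w G c (DenseUZ A X) = 0"
| "xweight w G c (CenterC A i) = pot w (induced G A) (c A)"
| "xweight w G c (DenseCZ A i) = 0"

fun lower :: "nat \<Rightarrow> nat \<Rightarrow> 'a graph \<Rightarrow> 'a xvert \<Rightarrow> nat" where
  "lower p t G (Orig v) = (if degree G v = t + 1 then 1 else 0)"
| "lower p t G (ProbU H X) = 1"
| "lower p t G (ProbZ H) = p - 2"
| "lower p t G (DenseU A X) = 1"
| "lower p t G (DenseC A) = 2"
| "lower p t G (DenseZ A) = p - card (core t G A) div 2"

fun upper :: "nat \<Rightarrow> nat \<Rightarrow> 'a graph \<Rightarrow> 'a xvert \<Rightarrow> nat" where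
  "upper p t G (Orig v) = (if degree G v = t + 1 then t + 1 else degree G v)"
| "upper p t G (ProbU H X) = 1"
| "upper p t G (ProbZ H) = p - 2"
| "upper p t G (DenseU A X) = 1"
| "upper p t G (DenseC A) = 2"
| "upper p t G (DenseZ A) = p - card (core t G A) div 2"

end

theory Submission
  imports Defs
begin

text \<open>
Since every degree is at most $t + 1 = 2p - 1$, two $K^p_2$'s sharing a vertex either have the same
vertex set (which is then dense), or they are two of the three $K^p_2$'s obtained from a set $W$ of
$2p - 2$ vertices, all joined to each of three vertices $x, y, z$, by deleting one of $x, y, z$.
Moreover a $K^p_2$ that meets a dense set $A$ has vertex set $A$.

Replace every gadget by the single edge joining the two vertices it is matched to; the weight does
not change, because the weight is a sum of potentials. Only if both parallel edges at the center $c$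
of a dense set $A$ are used, there is no such edge, and one is left with a credit $2 r(c)$. If some
chosen edge $ab$ inside $A$ avoids $c$, it may be replaced by $ca$ and $cb$, at the cost of exactly
$2 r(c)$; otherwise all core vertices are covered by edges at $c$. Either way two chosen edges meet
in $c$, and no perfect matching contains both, so all $K^p_2$'s in $A$ are covered. The same
exchange settles the dense sets with $r(c) < 0$.

A $K^p_2$ that is still not covered is unproblematic, say on $W \<union> \{y, z\}$ with a
$K^p_2$ on $W \<union> \{x, z\}$ that is at least as heavy. All vertices of $W$ have degree
$t + 1$ and are therefore covered by edges to $x$. For some $u \<in> W$ the edge $uy$ is not
heavier than $ux$, and exchanging $ux$ for $uy$ covers all three $K^p_2$'s.
\<close>

subsection \<open>Complete multipartite graphs as complements of perfect matchings\<close>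

text \<open>A fixed-point-free involution encodes a partition of \<open>A\<close> into pairs {u, m
  u}. With it, colour classes are handled through a function on vertices instead of a family of
  sets.\<close>

definition mating :: "'a set \<Rightarrow> ('a \<Rightarrow> 'a) \<Rightarrow> bool" where
  "mating A m \<longleftrightarrow> (\<forall>u\<in>A. m u \<in> A \<and> m u \<noteq> u \<and> m (m u) = u)"

definition mate_graph :: "'a set \<Rightarrow> ('a \<Rightarrow> 'a) \<Rightarrow> 'a graph" where
  "mate_graph A m = Graph A {{u, v} | u v. u \<in> A \<and> v \<in> A \<and> u \<noteq> v \<and> v \<noteq> m u}"

lemma verts_mate_graph [simp]: "verts (mate_graph A m) = A"
  by (simp add: mate_graph_def)

lemma mate_graph_edge_iff:
  assumes "mating A m"
  shows "{u, v} \<in> edges (mate_graph A m) \<longleftrightarrow> u \<in> A \<and> v \<in> A \<and> u \<noteq> v \<and> v \<noteq> m u"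
  using assms unfolding mate_graph_def mating_def by (auto simp: doubleton_eq_iff)

lemma mate_graph_edgeE:
  assumes "e \<in> edges (mate_graph A m)"
  obtains u v where "e = {u, v}" "u \<in> A" "v \<in> A" "u \<noteq> v" "v \<noteq> m u"
  using assms unfolding mate_graph_def by auto

lemma mate_graph_cong:
  assumes "\<And>u. u \<in> A \<Longrightarrow> m u = m' u"
  shows "mate_graph A m = mate_graph A m'"
  using assms unfolding mate_graph_def by fastforce

text \<open>Because \<open>m\<close> is an involution, a class is determined by any of its elements.
  The classes are therefore disjoint pairs, and counting gives exactly p of them.\<close>

lemma Kp2_classes_mate_graph:
  assumes m: "mating A m" and card: "card A = 2 * p" and p: "p > 0"
  shows "Kp2_classes p (mate_graph A m) ((\<lambda>u. {u, m u}) ` A)"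
proof -
  let ?P = "(\<lambda>u. {u, m u}) ` A"
  have fin: "finite A" using card p by (metis card.infinite mult_eq_0_iff neq0_conv zero_neq_numeral)
  have two: "card X = 2" if "X \<in> ?P" for X
    using that m unfolding mating_def by (auto simp: card_2_iff)
  have U: "\<Union>?P = A" using m unfolding mating_def by auto
  have cls: "X = {x, m x}" if "X \<in> ?P" "x \<in> X" for X x
    using that m unfolding mating_def by auto
  have disj: "X \<inter> Y = {}" if "X \<in> ?P" "Y \<in> ?P" "X \<noteq> Y" for X Y
  proof (rule ccontr)
    assume "X \<inter> Y \<noteq> {}"
    then obtain x where "x \<in> X" "x \<in> Y" by blast
    then show False using cls that by metis
  qed
  have "2 * card ?P = card (\<Union>?P)"
    using fin two disj U by (intro card_partition) auto
  then have cP: "card ?P = p" using U card by simp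
  have part: "partition_on A ?P"
    using U disj by (auto simp: partition_on_def disjoint_def)
  have "edges (mate_graph A m)
      = {{u, v} | u v X Y. X \<in> ?P \<and> Y \<in> ?P \<and> X \<noteq> Y \<and> u \<in> X \<and> v \<in> Y}" (is "_ = ?E")
  proof (intro equalityI subsetI)
    fix e assume "e \<in> edges (mate_graph A m)"
    then obtain u v where uv: "e = {u, v}" "u \<in> A" "v \<in> A" "u \<noteq> v" "v \<noteq> m u"
      by (rule mate_graph_edgeE)
    then have "{u, m u} \<noteq> {v, m v}" by (auto simp: doubleton_eq_iff)
    then show "e \<in> ?E" using uv by blast
  next
    fix e assume "e \<in> ?E"
    then obtain u v X Y where e: "e = {u, v}" "X \<in> ?P" "Y \<in> ?P" "X \<noteq> Y" "u \<in> X" "v \<in> Y"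
      by blast
    have "X \<inter> Y = {}" using disj e by blast
    moreover have "X = {u, m u}" "u \<in> A" using e(2,5) m unfolding mating_def by auto
    moreover have "v \<in> A" using e(3,6) m unfolding mating_def by auto
    ultimately have "u \<in> A" "v \<in> A" "u \<noteq> v" "v \<noteq> m u" using e by auto
    then show "e \<in> edges (mate_graph A m)" using e mate_graph_edge_iff[OF m] by simp
  qed
  then show ?thesis
    using part fin cP two unfolding Kp2_classes_def by simp
qed

lemma colour_classes_mate_graph:
  assumes "mating A m" "card A = 2 * p" "p > 0"
  shows "colour_classes p (mate_graph A m) = (\<lambda>u. {u, m u}) ` A"
  using Kp2_classes_mate_graph[OF assms] by (rule colour_classes_eqI)

text \<open>Given a partition into pairs, \<open>m\<close> sends each vertex to the other element of
  its class. From here on copies of $K^p_2$ are handled only through matings.\<close>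

lemma is_Kp2_iff:
  assumes "p > 0"
  shows "is_Kp2 p H \<longleftrightarrow> (\<exists>A m. mating A m \<and> card A = 2 * p \<and> H = mate_graph A m)"
proof
  assume "is_Kp2 p H"
  then obtain P where P: "Kp2_classes p H P" by (auto simp: is_Kp2_def)
  then have U: "\<Union>P = verts H" and disj: "\<And>X Y. X \<in> P \<Longrightarrow> Y \<in> P \<Longrightarrow> X \<noteq> Y \<Longrightarrow> X \<inter> Y = {}"
    and two: "\<And>X. X \<in> P \<Longrightarrow> card X = 2" and cP: "card P = p" and fin: "finite P"
    and E: "edges H = {{u, v} | u v X Y. X \<in> P \<and> Y \<in> P \<and> X \<noteq> Y \<and> u \<in> X \<and> v \<in> Y}"
    by (auto simp: Kp2_classes_def partition_on_def disjoint_def)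
  have "\<exists>v. v \<noteq> u \<and> {u, v} \<in> P" if "u \<in> verts H" for u
  proof -
    obtain X where "X \<in> P" "u \<in> X" using \<open>u \<in> verts H\<close> U by auto
    then show ?thesis using two[of X] by (auto simp: card_2_iff insert_commute)
  qed
  then obtain m where m: "\<And>u. u \<in> verts H \<Longrightarrow> m u \<noteq> u \<and> {u, m u} \<in> P" by metis
  have mV: "m u \<in> verts H" if "u \<in> verts H" for u using m[OF that] U by auto
  have same: "{u, m u} = X" if "u \<in> X" "X \<in> P" for u X
    using that m[of u] U disj[of X "{u, m u}"] by auto
  have mm: "m (m u) = u" if "u \<in> verts H" for u
    using same[of "m u" "{u, m u}"] m[OF that] m[OF mV[OF that]] by (auto simp: doubleton_eq_iff)
  have mat: "mating (verts H) m" using m mV mm unfolding mating_def by blast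
  have fX: "finite X" if "X \<in> P" for X using two[OF that] by (metis card.infinite zero_neq_numeral)
  have "finite (\<Union>P)" using fin fX by auto
  then have "2 * card P = card (\<Union>P)"
    using fin two disj by (intro card_partition) auto
  then have card: "card (verts H) = 2 * p" using U cP by simp
  have "edges H = edges (mate_graph (verts H) m)"
  proof (intro equalityI subsetI)
    fix e assume "e \<in> edges H"
    then obtain u v X Y where e: "e = {u, v}" "X \<in> P" "Y \<in> P" "X \<noteq> Y" "u \<in> X" "v \<in> Y"
      unfolding E by blast
    have "X \<inter> Y = {}" using disj e(2,3,4) .
    moreover have "{u, m u} = X" using same e(5,2) .
    moreover have uv: "u \<in> verts H" "v \<in> verts H" unfolding U[symmetric] using e by blast+
    ultimately have "v \<noteq> m u" "u \<noteq> v" using e by auto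
    then show "e \<in> edges (mate_graph (verts H) m)"
      using e uv by (simp add: mate_graph_edge_iff[OF mat])
  next
    fix e assume "e \<in> edges (mate_graph (verts H) m)"
    then obtain u v where uv: "e = {u, v}" "u \<in> verts H" "v \<in> verts H" "u \<noteq> v" "v \<noteq> m u"
      by (rule mate_graph_edgeE)
    then have "{u, m u} \<noteq> {v, m v}" by (auto simp: doubleton_eq_iff)
    then show "e \<in> edges H" using uv m[of u] m[of v] unfolding E by blast
  qed
  then have "H = mate_graph (verts H) m" by (simp add: mate_graph_def graph.expand)
  then show "\<exists>A m. mating A m \<and> card A = 2 * p \<and> H = mate_graph A m"
    using mat card by metis
next
  assume "\<exists>A m. mating A m \<and> card A = 2 * p \<and> H = mate_graph A m"
  then show "is_Kp2 p H" using Kp2_classes_mate_graph assms by (auto simp: is_Kp2_def)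
qed

section \<open>Copies of $K^p_2$ in graphs of maximum degree at most 2p - 1\<close>

locale bounded_graph =
  fixes p :: nat and G :: "'a graph"
  assumes p3: "p \<ge> 3" and simple: "simple_graph G"
    and degree_le: "v \<in> verts G \<Longrightarrow> degree G v \<le> 2 * p - 1"
begin

text \<open>Edges between mates are neither required nor forbidden in \<open>G\<close>: copies need
  not be induced, and one set \<open>A\<close> may carry several of them.\<close>

definition mates :: "'a set \<Rightarrow> ('a \<Rightarrow> 'a) \<Rightarrow> bool" where
  "mates A m \<longleftrightarrow> mating A m \<and> card A = 2 * p \<and> A \<subseteq> verts G \<and>
     (\<forall>u\<in>A. \<forall>v\<in>A. u \<noteq> v \<longrightarrow> v \<noteq> m u \<longrightarrow> {u, v} \<in> edges G)"

lemma Kp2s_iff: "H \<in> Kp2s p G \<longleftrightarrow> (\<exists>A m. mates A m \<and> H = mate_graph A m)"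
proof
  assume H: "H \<in> Kp2s p G"
  then obtain A m where A: "mating A m" "card A = 2 * p" "H = mate_graph A m"
    using p3 by (auto simp: Kp2s_def is_Kp2_iff)
  moreover have "A \<subseteq> verts G" "edges (mate_graph A m) \<subseteq> edges G"
    using H A(3) by (auto simp: Kp2s_def subgraph_def)
  ultimately have "mates A m"
    unfolding mates_def using mate_graph_edge_iff[OF A(1)] by blast
  then show "\<exists>A m. mates A m \<and> H = mate_graph A m" using A(3) by blast
next
  assume "\<exists>A m. mates A m \<and> H = mate_graph A m"
  then obtain A m where A: "mates A m" "H = mate_graph A m" by blast
  have "is_Kp2 p H" using A p3 is_Kp2_iff[of p H] unfolding mates_def by auto
  moreover have "subgraph H G"
    using A unfolding mates_def subgraph_def by (auto elim!: mate_graph_edgeE)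
  ultimately show "H \<in> Kp2s p G" by (simp add: Kp2s_def)
qed

lemma mates_mate_graph: "mates A m \<Longrightarrow> mate_graph A m \<in> Kp2s p G"
  using Kp2s_iff by blast

lemma matesD:
  assumes "mates A m" "u \<in> A"
  shows "m u \<in> A" "m u \<noteq> u" "m (m u) = u"
  using assms unfolding mates_def mating_def by auto

lemma mates_adj: "mates A m \<Longrightarrow> u \<in> A \<Longrightarrow> v \<in> A \<Longrightarrow> u \<noteq> v \<Longrightarrow> v \<noteq> m u \<Longrightarrow> {u, v} \<in> edges G"
  unfolding mates_def by blast

lemma mates_edge_iff:
  "mates A m \<Longrightarrow> {u, v} \<in> edges (mate_graph A m) \<longleftrightarrow> u \<in> A \<and> v \<in> A \<and> u \<noteq> v \<and> v \<noteq> m u"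
  unfolding mates_def by (auto simp: mate_graph_edge_iff)

lemma mates_card: "mates A m \<Longrightarrow> card A = 2 * p"
  by (simp add: mates_def)

lemma mates_finite: "mates A m \<Longrightarrow> finite A"
  using mates_card[of A m] p3 by (intro card_ge_0_finite) simp

lemma finite_verts: "finite (verts G)"
  using simple by (simp add: simple_graph_def)

lemma edge_verts: "{u, v} \<in> edges G \<Longrightarrow> u \<in> verts G \<and> v \<in> verts G \<and> u \<noteq> v"
  using simple unfolding simple_graph_def by fastforce

lemma edgeE:
  assumes "e \<in> edges G"
  obtains u v where "e = {u, v}" "u \<noteq> v"
  using assms simple unfolding simple_graph_def by (metis card_2_iff)

lemma edge_atE:
  assumes "e \<in> edges G" "u \<in> e"
  obtains v where "e = {u, v}" "u \<noteq> v"
  using assms by (elim edgeE) (auto simp: insert_commute)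

lemma finite_edges: "finite (edges G)"
proof (rule finite_subset)
  show "edges G \<subseteq> Pow (verts G)" using simple by (auto simp: simple_graph_def)
qed (simp add: finite_verts)

lemma finite_neighbours: "finite (neighbours G v)"
  by (rule finite_subset[OF _ finite_verts]) (auto simp: neighbours_def dest: edge_verts)

lemma degree_eq_card_neighbours: "degree G v = card (neighbours G v)"
  unfolding deg_in_def
proof (rule bij_betw_same_card[symmetric, of "\<lambda>u. {u, v}"])
  show "bij_betw (\<lambda>u. {u, v}) (neighbours G v) {e \<in> edges G. v \<in> e}"
  proof (rule bij_betwI')
    fix e assume "e \<in> {e \<in> edges G. v \<in> e}"
    then obtain u where "e = {v, u}" "e \<in> edges G" by (auto elim: edge_atE)
    then show "\<exists>u\<in>neighbours G v. e = {u, v}" by (auto simp: neighbours_def insert_commute)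
  qed (auto simp: neighbours_def doubleton_eq_iff)
qed

lemma card_adj_le:
  assumes "v \<in> verts G" "\<And>u. u \<in> S \<Longrightarrow> {v, u} \<in> edges G"
  shows "card S \<le> 2 * p - 1"
proof -
  have "card S \<le> card (neighbours G v)"
    using assms(2) by (intro card_mono finite_neighbours) (auto simp: neighbours_def insert_commute)
  then show ?thesis using degree_le[OF assms(1)] by (simp add: degree_eq_card_neighbours)
qed

text \<open>Within the copy u already has 2p - 2 neighbours, so the degree bound leaves room for one
  more: either its mate or a single vertex outside \<open>A\<close>. The structural lemmas below all
  rest on this count.\<close>

lemma extra_neighbour_unique:
  assumes "mates A m" "u \<in> A" "{u, x} \<in> edges G" "{u, y} \<in> edges G"
    and "x \<notin> A \<or> x = m u" "y \<notin> A \<or> y = m u"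
  shows "x = y"
proof (rule ccontr)
  assume "x \<noteq> y"
  let ?B = "A - {u, m u}"
  have fin: "finite A" using assms(1) by (rule mates_finite)
  have "card ?B = 2 * p - 2"
    using matesD[OF assms(1,2)] assms(2) mates_card[OF assms(1)] fin by (subst card_Diff_subset) auto
  moreover have "card (insert x (insert y ?B)) = Suc (Suc (card ?B))"
    using assms fin \<open>x \<noteq> y\<close> by auto
  moreover have "card (insert x (insert y ?B)) \<le> 2 * p - 1"
    using assms mates_adj[OF assms(1,2)] edge_verts by (intro card_adj_le[of u]) blast+
  ultimately show False using p3 by simp
qed

end

subsection \<open>Intersecting subgraphs\<close>

text \<open>Meant for a mating \<open>m\<close> of \<open>W\<close> and two vertices outside
  \<open>W\<close>: the classes of \<open>W\<close> are kept and {x, y} is added as a further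
  class.\<close>

definition pair_graph :: "'a set \<Rightarrow> ('a \<Rightarrow> 'a) \<Rightarrow> 'a \<Rightarrow> 'a \<Rightarrow> 'a graph" where
  "pair_graph W m x y = mate_graph (insert x (insert y W)) (m(x := y, y := x))"

lemma verts_pair_graph [simp]: "verts (pair_graph W m x y) = insert x (insert y W)"
  by (simp add: pair_graph_def)

lemma pair_graph_commute: "pair_graph W m x y = pair_graph W m y x"
  unfolding pair_graph_def by (cases "x = y") (simp_all add: insert_commute fun_upd_twist)

lemma edges_pair_graph:
  assumes m: "mating W m" and xy: "x \<notin> W" "y \<notin> W" "x \<noteq> y"
  shows "edges (pair_graph W m x y)
    = edges (mate_graph W m) \<union> (\<lambda>u. {u, x}) ` W \<union> (\<lambda>u. {u, y}) ` W" (is "?L = ?R")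
proof (intro equalityI subsetI)
  fix e assume "e \<in> ?L"
  then obtain u v where uv: "e = {u, v}" "u \<in> insert x (insert y W)" "v \<in> insert x (insert y W)"
      "u \<noteq> v" "v \<noteq> (m(x := y, y := x)) u"
    unfolding pair_graph_def by (rule mate_graph_edgeE)
  show "e \<in> ?R"
  proof (cases "u \<in> W \<and> v \<in> W")
    case True
    then have "v \<noteq> m u" using uv xy by (auto split: if_splits)
    then show ?thesis using uv True by (simp add: mate_graph_edge_iff[OF m])
  next
    case False
    then show ?thesis using uv xy by (auto simp: insert_commute split: if_splits)
  qed
next
  have m': "mating (insert x (insert y W)) (m(x := y, y := x))"
    using m xy unfolding mating_def by auto
  have ne: "m u \<noteq> x" "m u \<noteq> y" if "u \<in> W" for u using m xy that unfolding mating_def by auto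
  fix e assume "e \<in> ?R"
  then consider u v where "e = {u, v}" "u \<in> W" "v \<in> W" "u \<noteq> v" "v \<noteq> m u"
    | u where "u \<in> W" "e = {u, x}" | u where "u \<in> W" "e = {u, y}"
    by (auto elim!: mate_graph_edgeE)
  then show "e \<in> ?L"
    using xy ne unfolding pair_graph_def by cases (auto simp: mate_graph_edge_iff[OF m'])
qed

context bounded_graph
begin

text \<open>The configuration formed by two copies that meet but have different vertex sets: p - 1
  common classes on \<open>W\<close>, and three vertices any two of which can serve as the last
  class. Adjacency among x, y, z is left open.\<close>

definition triple :: "'a set \<Rightarrow> ('a \<Rightarrow> 'a) \<Rightarrow> 'a \<Rightarrow> 'a \<Rightarrow> 'a \<Rightarrow> bool" where
  "triple W m x y z \<longleftrightarrow> mating W m \<and> card W = 2 * p - 2 \<and>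
     x \<notin> W \<and> y \<notin> W \<and> z \<notin> W \<and> x \<noteq> y \<and> x \<noteq> z \<and> y \<noteq> z \<and>
     (\<forall>u\<in>W. \<forall>v\<in>W. u \<noteq> v \<longrightarrow> v \<noteq> m u \<longrightarrow> {u, v} \<in> edges G) \<and>
     (\<forall>u\<in>W. {u, x} \<in> edges G \<and> {u, y} \<in> edges G \<and> {u, z} \<in> edges G)"

lemma triple_swap: "triple W m x y z \<Longrightarrow> triple W m x z y"
  unfolding triple_def by auto

lemma triple_finite: "triple W m x y z \<Longrightarrow> finite W"
  using p3 unfolding triple_def by (intro card_ge_0_finite) simp

lemma triple_nonempty: "triple W m x y z \<Longrightarrow> W \<noteq> {}"
  using p3 unfolding triple_def by auto

lemma triple_mates:
  assumes "triple W m x y z"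
  shows "mates (insert x (insert y W)) (m(x := y, y := x))"
proof -
  have fin: "finite W" using assms by (rule triple_finite)
  obtain u where u: "u \<in> W" using triple_nonempty[OF assms] by blast
  have W: "v \<in> verts G" if "v \<in> W" for v
    using assms that edge_verts unfolding triple_def by blast
  have V: "insert x (insert y W) \<subseteq> verts G"
    using assms u W edge_verts unfolding triple_def by blast
  have ne: "m u \<noteq> x" "m u \<noteq> y" if "u \<in> W" for u
    using assms that unfolding triple_def mating_def by auto
  have "mating (insert x (insert y W)) (m(x := y, y := x))"
    using assms unfolding triple_def mating_def by auto
  moreover have "card (insert x (insert y W)) = 2 * p"
    using assms fin p3 unfolding triple_def by simp
  moreover have "{a, b} \<in> edges G"
    if "a \<in> insert x (insert y W)" "b \<in> insert x (insert y W)" "a \<noteq> b"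
      "b \<noteq> (m(x := y, y := x)) a" for a b
  proof (cases "a \<in> W \<and> b \<in> W")
    case True
    moreover have "b \<noteq> m a" using that True assms unfolding triple_def by (auto split: if_splits)
    ultimately show ?thesis using assms that unfolding triple_def by blast
  next
    case False
    then show ?thesis using that assms unfolding triple_def
      by (auto simp: insert_commute split: if_splits)
  qed
  ultimately show ?thesis using V unfolding mates_def by blast
qed

text \<open>In the copy with last class {x, y}, the vertex z is the one extra neighbour that u can
  have. Hence u is not adjacent to its mate, nor to anything further away.\<close>

lemma triple_neighbour:
  assumes "triple W m x y z" "u \<in> W" "{u, v} \<in> edges G"
  shows "v \<in> W \<union> {x, y, z} \<and> v \<noteq> m u"
proof -
  have mu: "m u \<in> W" using assms unfolding triple_def mating_def by auto
  have "(m(x := y, y := x)) u = m u" using assms unfolding triple_def by auto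
  then have "v = z" if "v \<notin> insert x (insert y W) \<or> v = m u"
    using extra_neighbour_unique[OF triple_mates[OF assms(1)], of u v z] that assms
    unfolding triple_def by auto
  then show ?thesis using mu assms unfolding triple_def by auto
qed

text \<open>Apart from its mate, a common vertex can be joined to at most one vertex of
  \<open>A' - A\<close>. This forces the two sets to differ by exchanging a single vertex y for x;
  then y and x have the same mate z, and all other mates agree.\<close>

lemma mates_share:
  assumes A: "mates A m" and A': "mates A' m'" and v: "v \<in> A" "v \<in> A'" and ne: "A \<noteq> A'"
  obtains W x y z where "triple W m x y z" "A = insert y (insert z W)" "A' = insert x (insert z W)"
    "m y = z" "m' x = z" "\<And>u. u \<in> W \<Longrightarrow> m' u = m u"
proof -
  note fin = mates_finite[OF A] mates_finite[OF A']
  have cards: "card A = 2 * p" "card A' = 2 * p" using A A' by (auto simp: mates_card)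
  \<comment> \<open>In the copy on \<open>A'\<close>, u is adjacent to both a and b; both lie
    outside \<open>A\<close> and compete for its only extra neighbour.\<close>
  have two_new: "a = b" if "u \<in> A" "u \<in> A'" "a \<in> A' - A" "b \<in> A' - A" "u \<noteq> m' a" "u \<noteq> m' b" for u a b
  proof -
    have "a \<noteq> m' u" "b \<noteq> m' u" using that matesD[OF A'] by auto
    then have "{u, a} \<in> edges G" "{u, b} \<in> edges G" using that mates_adj[OF A', of u] by auto
    then show "a = b" using extra_neighbour_unique[OF A that(1)] that by blast
  qed
  have c_eq: "card (A' - A) = card (A - A')"
    using fin cards by (simp add: card_Diff_subset_Int Int_commute)
  have c_int: "card (A \<inter> A') + card (A' - A) = 2 * p"
    using fin cards by (metis Int_commute add.commute card_Diff_subset_Int card_mono finite_Int inf_le1 le_add_diff_inverse2 inf.cobounded1)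
  \<comment> \<open>A first, crude bound from the one vertex known to be common: at most two
    vertices are new, which leaves at least 2p - 2 >= 4 common ones.\<close>
  have "card (A' - A - {m' v}) \<le> 1"
  proof (subst card_le_Suc0_iff_eq[unfolded One_nat_def[symmetric]])
    show "\<forall>a\<in>A' - A - {m' v}. \<forall>b\<in>A' - A - {m' v}. a = b"
      using two_new[OF v] matesD[OF A'] v by (metis DiffE DiffI insertI1)
  qed (use fin in simp)
  then have "card (A' - A) \<le> 2"
    using card_Diff_singleton_if[of "A' - A" "m' v"] by (auto split: if_splits)
  then have "card (A \<inter> A') \<ge> 4" using c_int p3 by linarith
  have "card (A' - A) \<le> 1"
  proof (subst card_le_Suc0_iff_eq[unfolded One_nat_def[symmetric]])
    show "\<forall>a\<in>A' - A. \<forall>b\<in>A' - A. a = b"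
    proof (intro ballI)
      fix a b assume ab: "a \<in> A' - A" "b \<in> A' - A"
      \<comment> \<open>Four common vertices suffice to pick one that is the mate of neither a nor
        b.\<close>
      have "card (A \<inter> A' - {m' a, m' b}) > 0"
        using \<open>card (A \<inter> A') \<ge> 4\<close> diff_card_le_card_Diff[of "{m' a, m' b}" "A \<inter> A'"]
          card_insert_le_m1[of 2 "{m' b}" "m' a"] by simp
      then obtain u where "u \<in> A \<inter> A'" "u \<noteq> m' a" "u \<noteq> m' b" by (auto simp: card_gt_0_iff)
      then show "a = b" using two_new ab by blast
    qed
  qed (use fin in simp)
  moreover have "A' - A \<noteq> {}" using ne fin cards by (metis Diff_eq_empty_iff card_subset_eq)
  ultimately have "card (A' - A) = 1" using fin by (metis One_nat_def card_0_eq finite_Diff le_Suc_eq le_zero_eq)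
  moreover from this have "card (A - A') = 1" using c_eq by simp
  ultimately obtain x y where xy: "A' - A = {x}" "A - A' = {y}" by (meson card_1_singletonE)
  define B where "B = A \<inter> A'"
  have B: "A = insert y B" "A' = insert x B" "x \<notin> A" "y \<notin> A'" "y \<in> A" "x \<in> A'"
    using xy unfolding B_def by auto
  \<comment> \<open>Such a vertex has x as its extra neighbour, so it is not adjacent to
    \<open>m u\<close> in \<open>G\<close>. The copy on \<open>A'\<close> contains both vertices and
    lacks this edge, hence they are mates there too.\<close>
  have same: "m u \<in> B \<and> m' u = m u \<and> {u, x} \<in> edges G \<and> {u, y} \<in> edges G"
    if u: "u \<in> B" "u \<noteq> m y" "u \<noteq> m' x" for u
  proof -
    have uA: "u \<in> A" "u \<in> A'" using u B by auto
    have "x \<noteq> m' u" "y \<noteq> m u" using u uA matesD[OF A] matesD[OF A'] B by metis+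
    moreover have "u \<noteq> x" "u \<noteq> y" using uA B by auto
    ultimately have adj: "{u, x} \<in> edges G" "{u, y} \<in> edges G"
      using mates_adj[OF A] mates_adj[OF A'] uA B by auto
    have mu: "m u \<in> A" "m u \<noteq> u" using matesD[OF A uA(1)] by auto
    have "m u \<in> B" using mu \<open>y \<noteq> m u\<close> B by auto
    have "{u, m u} \<notin> edges G"
      using extra_neighbour_unique[OF A uA(1), of "m u" x] adj mu B by auto
    then have "m u = m' u" using mates_adj[OF A' uA(2), of "m u"] \<open>m u \<in> B\<close> B mu by auto
    then show ?thesis using adj \<open>m u \<in> B\<close> by simp
  qed
  define z where "z = m y"
  have z: "z \<in> A" "z \<noteq> y" "m z = y" using matesD[OF A] B unfolding z_def by auto
  \<comment> \<open>Otherwise \<open>same\<close> applies to the common vertex \<open>m' z\<close>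
    and makes z its mate in \<open>A\<close>. But z is the mate of y, which is not common.\<close>
  have "m' x = z"
  proof (rule ccontr)
    assume *: "m' x \<noteq> z"
    have zA': "z \<in> A'" "z \<noteq> x" using z B by auto
    let ?u = "m' z"
    have u: "?u \<in> A'" "?u \<noteq> z" "m' ?u = z" using matesD[OF A'] zA' by auto
    have "?u \<noteq> x" using * u by auto
    then have "?u \<in> B" using u B by auto
    moreover have "?u \<noteq> m' x" using matesD(3)[OF A'] zA' B by metis
    ultimately have "m ?u = z" "?u \<in> A" using same[of ?u] u B unfolding z_def by auto
    then have "?u = y" using matesD(3)[OF A] z by metis
    then show False using \<open>?u \<in> B\<close> B by auto
  qed
  define W where "W = B - {z}"
  have zB: "z \<in> B" using z B by auto
  have W: "A = insert y (insert z W)" "A' = insert x (insert z W)" "y \<notin> W" "x \<notin> W" "z \<notin> W"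
    "x \<noteq> y" "x \<noteq> z" "y \<noteq> z"
    using B zB z unfolding W_def by auto
  have inW: "m u \<in> W \<and> m' u = m u \<and> {u, x} \<in> edges G \<and> {u, y} \<in> edges G" if "u \<in> W" for u
  proof -
    have "u \<in> B" "u \<noteq> m y" "u \<noteq> m' x" using that \<open>m' x = z\<close> unfolding W_def z_def by auto
    moreover have "m u \<noteq> z" using that W z matesD(3)[OF A, of u] by auto
    ultimately show ?thesis using same[of u] unfolding W_def by auto
  qed
  have "mating W m" using inW matesD[OF A] W unfolding mating_def by auto
  moreover have "card W = 2 * p - 2" using cards fin W by auto
  moreover have "{u, v} \<in> edges G" if "u \<in> W" "v \<in> W" "u \<noteq> v" "v \<noteq> m u" for u v
    using mates_adj[OF A, of u v] that W by auto
  moreover have "{u, z} \<in> edges G" if "u \<in> W" for u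
    using mates_adj[OF A, of u z] that W inW[OF that] by auto
  ultimately have "triple W m x y z" using W inW unfolding triple_def by auto
  then show thesis
    using that W inW \<open>m' x = z\<close> unfolding z_def by blast
qed

text \<open>On the same vertex set, mates inside \<open>W\<close> are not adjacent in
  \<open>G\<close>, so \<open>m'\<close> is forced. On a different one, \<open>mates_share\<close>
  yields a second triple, which is then identified with the given one.\<close>

lemma mates_meeting_pair:
  assumes T: "triple W m x y z" and A': "mates A' m'" and meet: "A' \<inter> insert x (insert y W) \<noteq> {}"
  shows "mate_graph A' m' \<in> {pair_graph W m x y, pair_graph W m x z, pair_graph W m y z}"
proof -
  let ?A = "insert x (insert y W)" and ?m = "m(x := y, y := x)"
  have A: "mates ?A ?m" using T by (rule triple_mates)
  have T': "x \<notin> W" "y \<notin> W" "z \<notin> W" "x \<noteq> y" "x \<noteq> z" "y \<noteq> z" "mating W m" "card W = 2 * p - 2"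
    "\<And>u. u \<in> W \<Longrightarrow> {u, x} \<in> edges G \<and> {u, y} \<in> edges G \<and> {u, z} \<in> edges G"
    using T unfolding triple_def by auto
  have fin: "finite W" using T by (rule triple_finite)
  show ?thesis
  proof (cases "A' = ?A")
    case True
    have W: "m' u = m u" if "u \<in> W" for u
    proof (rule ccontr)
      assume "m' u \<noteq> m u"
      moreover have "m u \<in> W" "u \<noteq> m u" using T'(7) that unfolding mating_def by auto
      ultimately have "{u, m u} \<in> edges G" using mates_adj[OF A', of u "m u"] that True by auto
      then show False using triple_neighbour[OF T that] by blast
    qed
    have "m' x \<notin> W"
    proof
      assume "m' x \<in> W"
      then have "m' (m' x) = m (m' x)" "m (m' x) \<in> W" using W T'(7) unfolding mating_def by auto
      then show False using matesD(3)[OF A', of x] True T' by auto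
    qed
    then have "m' x = y" using matesD(1,2)[OF A', of x] True by auto
    then have "m' y = x" using matesD(3)[OF A', of x] True by auto
    have "mate_graph A' m' = pair_graph W m x y"
      unfolding pair_graph_def True using W \<open>m' x = y\<close> \<open>m' y = x\<close> by (intro mate_graph_cong) auto
    then show ?thesis by simp
  next
    case False
    obtain v where v: "v \<in> ?A" "v \<in> A'" using meet by blast
    obtain W' x' y' z' where S: "triple W' ?m x' y' z'" "?A = insert y' (insert z' W')"
        "A' = insert x' (insert z' W')" "?m y' = z'" "m' x' = z'" "\<And>u. u \<in> W' \<Longrightarrow> m' u = ?m u"
      using mates_share[OF A A' v] False by metis
    have S': "x' \<notin> W'" "y' \<notin> W'" "z' \<notin> W'" "x' \<noteq> y'" "x' \<noteq> z'" "y' \<noteq> z'" "mating W' ?m"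
      "\<And>u. u \<in> W' \<Longrightarrow> {u, x'} \<in> edges G"
      using S(1) unfolding triple_def by auto
    have "y' \<in> ?A" unfolding S(2) by simp
    from matesD(3)[OF A this] have mz': "?m z' = y'" unfolding S(4) .
    have "W - {y', z'} \<noteq> {}"
    proof
      assume "W - {y', z'} = {}"
      then have "card W \<le> card {y', z'}" by (intro card_mono) auto
      also have "\<dots> \<le> 2" by (simp add: card_insert_if)
      finally show False using T'(8) p3 by simp
    qed
    then obtain u where u: "u \<in> W" "u \<in> W'" using S(2) by auto
    have "x' \<notin> ?A" using S(2) S' by auto
    \<comment> \<open>Both vertices lie outside the copy and are adjacent to u, which has only one
      such neighbour.\<close>
    then have "x' = z"
      using extra_neighbour_unique[OF A, of u x' z] u S'(8)[OF u(2)] T' by auto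
    \<comment> \<open>Both pairs are classes of the same mating, so if different they are disjoint.
      Then x and y would lie in \<open>W'\<close> and be adjacent to x' = z, giving z at least 2p
      neighbours.\<close>
    have yz: "{y', z'} = {x, y}"
    proof (rule ccontr)
      assume *: "{y', z'} \<noteq> {x, y}"
      have "y' \<notin> {x, y}" using * S(4) T' by (auto simp: insert_commute split: if_splits)
      moreover have "z' \<notin> {x, y}" using * mz' T' by (auto simp: insert_commute split: if_splits)
      ultimately have "x \<in> W'" "y \<in> W'" using S(2) by auto
      then have "{z, x} \<in> edges G" "{z, y} \<in> edges G"
        using S'(8) \<open>x' = z\<close> by (auto simp: insert_commute)
      then have "card (insert x (insert y W)) \<le> 2 * p - 1"
        using T'(9) edge_verts by (intro card_adj_le[of z]) (auto simp: insert_commute)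
      then show False using T' fin p3 by simp
    qed
    have "W' = ?A - {y', z'}" unfolding S(2) using S' by auto
    also have "\<dots> = W" unfolding yz using T' by auto
    finally have W': "W' = W" .
    have "mate_graph A' m' = pair_graph W m z z'"
      unfolding pair_graph_def S(3) W' \<open>x' = z\<close>
    proof (rule mate_graph_cong)
      fix u assume "u \<in> insert z (insert z' W)"
      moreover have "m' z = z'" using S(5) \<open>x' = z\<close> by simp
      moreover have "m' z' = z" using matesD(3)[OF A', of z] S(3) \<open>m' z = z'\<close> \<open>x' = z\<close> by auto
      moreover have "m' u = m u" if "u \<in> W" using S(6)[of u] that T' W' by auto
      moreover have "z' \<notin> W" "z' \<noteq> z" using S' W' \<open>x' = z\<close> by auto
      ultimately show "m' u = (m(z := z', z' := z)) u" using T' by auto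
    qed
    moreover have "z' = x \<or> z' = y" using yz by blast
    ultimately show ?thesis using pair_graph_commute by (metis insertCI)
  qed
qed

text \<open>A copy that avoids x, y and \<open>W\<close> can only meet the configuration in z; it is
  then caught by the triple with y and z interchanged.\<close>

lemma triple_Kp2s:
  assumes T: "triple W m x y z" and K: "K \<in> Kp2s p G" and meet: "verts K \<inter> (W \<union> {x, y, z}) \<noteq> {}"
  shows "K \<in> {pair_graph W m x y, pair_graph W m x z, pair_graph W m y z}"
proof -
  obtain A' m' where A': "mates A' m'" "K = mate_graph A' m'" using K by (auto simp: Kp2s_iff)
  show ?thesis
  proof (cases "A' \<inter> insert x (insert y W) = {}")
    case False
    then show ?thesis using mates_meeting_pair[OF T A'(1)] A'(2) by simp
  next
    case True
    then have "A' \<inter> insert x (insert z W) \<noteq> {}" using meet A' by auto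
    then show ?thesis
      using mates_meeting_pair[OF triple_swap[OF T] A'(1)] A'(2) pair_graph_commute
      by (metis insertCI insertE singletonD)
  qed
qed

lemma share_triple:
  assumes A: "mates A m" and A': "mates A' m'" and v: "v \<in> A" "v \<in> A'" and ne: "A \<noteq> A'"
  obtains W x y z where "triple W m x y z" "mate_graph A m = pair_graph W m y z"
    "mate_graph A' m' = pair_graph W m x z"
proof -
  obtain W x y z where S: "triple W m x y z" "A = insert y (insert z W)" "A' = insert x (insert z W)"
      "m y = z" "m' x = z" "\<And>u. u \<in> W \<Longrightarrow> m' u = m u"
    using mates_share[OF A A' v ne] by metis
  have "m z = y" "m' z = x" using matesD(3)[OF A, of y] matesD(3)[OF A', of x] S by auto
  moreover have "x \<notin> W" "y \<notin> W" "z \<notin> W" "y \<noteq> z" "x \<noteq> z" using S(1) unfolding triple_def by auto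
  ultimately have "mate_graph A m = pair_graph W m y z" "mate_graph A' m' = pair_graph W m x z"
    unfolding pair_graph_def S(2,3) using S(4-6) by (intro mate_graph_cong; auto)+
  then show thesis using that S(1) by blast
qed

text \<open>A copy on another set meeting \<open>A\<close> would place the first copy on
  \<open>A\<close> in a triple. Only three copies meet a triple, and just one of them has vertex set
  \<open>A\<close>, whereas \<open>A\<close> carries two.\<close>

lemma mates_closed:
  assumes A: "mates A m\<^sub>1" "mates A m\<^sub>2" and ne: "mate_graph A m\<^sub>1 \<noteq> mate_graph A m\<^sub>2"
    and B: "mates B m'" and meet: "A \<inter> B \<noteq> {}"
  shows "B = A"
proof (rule ccontr)
  assume "B \<noteq> A"
  obtain v where v: "v \<in> A" "v \<in> B" using meet by blast
  obtain W x y z where T: "triple W m\<^sub>1 x y z" "mate_graph A m\<^sub>1 = pair_graph W m\<^sub>1 y z"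
    using share_triple[OF A(1) B v] \<open>B \<noteq> A\<close> by metis
  have "verts (mate_graph A m\<^sub>1) = verts (pair_graph W m\<^sub>1 y z)" using T(2) by simp
  then have A_eq: "A = insert y (insert z W)" by simp
  moreover have "x \<notin> A" using T(1) A_eq unfolding triple_def by auto
  moreover have "mate_graph A m\<^sub>2 \<in> {pair_graph W m\<^sub>1 x y, pair_graph W m\<^sub>1 x z, pair_graph W m\<^sub>1 y z}"
    using T(1) mates_mate_graph[OF A(2)] by (rule triple_Kp2s) (use v A_eq in auto)
  ultimately have "mate_graph A m\<^sub>2 = pair_graph W m\<^sub>1 y z"
    by (metis insertCI insertE singletonD verts_mate_graph verts_pair_graph)
  then show False using ne T(2) by simp
qed

subsection \<open>Dense subgraphs\<close>

text \<open>The 2p - 2 vertices other than a and its mate are neighbours anyway. Degree 2p - 1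
  inside \<open>A\<close> therefore means adjacency to the mate, and conversely the mate uses up the
  extra neighbour, leaving none outside \<open>A\<close>.\<close>

lemma core_iff:
  assumes m: "mates A m" and a: "a \<in> A"
  shows "a \<in> core (2 * p - 2) G A \<longleftrightarrow> {a, m a} \<in> edges G"
proof -
  have fin: "finite A" and card: "card (A - {a}) = 2 * p - 1"
    using mates_finite[OF m] mates_card[OF m] a by auto
  have deg: "degree G a = card (neighbours G a)" by (rule degree_eq_card_neighbours)
  have ma: "m a \<in> A - {a}" using matesD[OF m a] by auto
  have t: "2 * p - 2 + 1 = 2 * p - 1" using p3 by simp
  show ?thesis
  proof
    assume c: "a \<in> core (2 * p - 2) G A"
    then have "neighbours G a \<subseteq> A" and "card (neighbours G a) = 2 * p - 1"
      unfolding core_def t by (simp_all add: deg)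
    moreover from this have "neighbours G a \<subseteq> A - {a}"
      by (auto simp: neighbours_def dest: edge_verts)
    ultimately have "neighbours G a \<subseteq> A - {a}" "card (neighbours G a) = 2 * p - 1" by auto
    then have "neighbours G a = A - {a}" using fin card by (intro card_subset_eq) auto
    then have "m a \<in> neighbours G a" using ma by simp
    then show "{a, m a} \<in> edges G" by (simp add: neighbours_def insert_commute)
  next
    assume e: "{a, m a} \<in> edges G"
    have "{a, v} \<in> edges G" if "v \<in> A - {a}" for v
      using mates_adj[OF m a, of v] e that by (cases "v = m a") auto
    then have "A - {a} \<subseteq> neighbours G a" by (auto simp: neighbours_def insert_commute)
    moreover have "neighbours G a \<subseteq> A"
      using extra_neighbour_unique[OF m a e] matesD(1)[OF m a]
      by (auto simp: neighbours_def insert_commute)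
    ultimately have "neighbours G a = A - {a}"
      by (auto simp: neighbours_def dest: edge_verts)
    then show "a \<in> core (2 * p - 2) G A"
      using a card deg t unfolding core_def by auto
  qed
qed

lemma core_subset: "core t G A \<subseteq> A"
  unfolding core_def by auto

lemma core_mate:
  assumes "mates A m" "a \<in> core (2 * p - 2) G A"
  shows "m a \<in> core (2 * p - 2) G A"
proof -
  have a: "a \<in> A" using assms(2) core_subset by blast
  show ?thesis
    using assms core_iff[OF assms(1) a] core_iff[OF assms(1), of "m a"] matesD[OF assms(1) a]
    by (simp add: insert_commute)
qed

lemma core_adj:
  assumes "mates A m" "a \<in> core (2 * p - 2) G A" "b \<in> A" "a \<noteq> b"
  shows "{a, b} \<in> edges G"
  using assms core_iff[OF assms(1), of a] mates_adj[OF assms(1), of a b] core_subset by fast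

text \<open>Outside the core, a is not adjacent to \<open>m a\<close>, so every copy on
  \<open>A\<close> has to put these two into one class. This is why the classes outside the core do
  not depend on the copy.\<close>

lemma outer_mate_eq:
  assumes "mates A m" "mates A m'" "a \<in> A" "a \<notin> core (2 * p - 2) G A"
  shows "m' a = m a"
  using assms core_iff[OF assms(1,3)] mates_adj[OF assms(2,3), of "m a"] matesD[OF assms(1,3)]
  by metis

lemma Kp2s_induced_iff:
  assumes "A \<subseteq> verts G" "card A = 2 * p"
  shows "K \<in> Kp2s p (induced G A) \<longleftrightarrow> (\<exists>m. mates A m \<and> K = mate_graph A m)"
proof
  assume K: "K \<in> Kp2s p (induced G A)"
  then have "K \<in> Kp2s p G" using assms by (auto simp: Kp2s_def subgraph_def induced_def)
  then obtain B m where B: "mates B m" "K = mate_graph B m" by (auto simp: Kp2s_iff)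
  have "finite A" using assms finite_verts finite_subset by blast
  moreover have "B \<subseteq> A" using K B by (auto simp: Kp2s_def subgraph_def induced_def)
  ultimately have "B = A" using mates_card[OF B(1)] assms by (intro card_subset_eq) auto
  then show "\<exists>m. mates A m \<and> K = mate_graph A m" using B by blast
next
  assume "\<exists>m. mates A m \<and> K = mate_graph A m"
  then obtain m where m: "mates A m" "K = mate_graph A m" by blast
  then have "K \<in> Kp2s p G" by (auto simp: Kp2s_iff)
  then show "K \<in> Kp2s p (induced G A)"
    using m assms by (auto simp: Kp2s_def subgraph_def induced_def mate_graph_def)
qed

lemma dense_set_iff:
  "dense_set p G A \<longleftrightarrow> (\<exists>m m'. mates A m \<and> mates A m' \<and> mate_graph A m \<noteq> mate_graph A m')"
proof
  assume "dense_set p G A"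
  then show "\<exists>m m'. mates A m \<and> mates A m' \<and> mate_graph A m \<noteq> mate_graph A m'"
    unfolding dense_set_def by (metis Kp2s_induced_iff)
next
  assume "\<exists>m m'. mates A m \<and> mates A m' \<and> mate_graph A m \<noteq> mate_graph A m'"
  then obtain m m' where m: "mates A m" "mates A m'" "mate_graph A m \<noteq> mate_graph A m'" by blast
  then have A: "A \<subseteq> verts G" "card A = 2 * p" by (auto simp: mates_def)
  then show "dense_set p G A"
    using m Kp2s_induced_iff[OF A] unfolding dense_set_def by blast
qed

lemma dense_closed:
  assumes "dense_set p G A" "K \<in> Kp2s p G" "A \<inter> verts K \<noteq> {}"
  shows "verts K = A"
  using assms mates_closed unfolding dense_set_iff Kp2s_iff by (metis verts_mate_graph)

text \<open>Two different copies disagree on the mate of some a. Then a, \<open>m a\<close>,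
  \<open>m' a\<close> and \<open>m (m' a)\<close> are four distinct core vertices.\<close>

lemma card_core_ge:
  assumes "dense_set p G A"
  shows "card (core (2 * p - 2) G A) \<ge> 4"
proof -
  let ?C = "core (2 * p - 2) G A"
  obtain m m' where m: "mates A m" "mates A m'" and ne: "mate_graph A m \<noteq> mate_graph A m'"
    using assms by (auto simp: dense_set_iff)
  obtain a where a: "a \<in> A" "m a \<noteq> m' a" using ne mate_graph_cong by metis
  have aC: "a \<in> ?C" using outer_mate_eq[OF m a(1)] a(2) by auto
  have "{a, m a, m' a, m (m' a)} \<subseteq> ?C" using aC m core_mate by blast
  moreover have "finite ?C" using mates_finite[OF m(1)] core_subset finite_subset by metis
  moreover have "card {a, m a, m' a, m (m' a)} = 4"
  proof -
    have b: "m' a \<in> A" "m' a \<noteq> a" using matesD[OF m(2) a(1)] by auto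
    have "m (m' a) \<noteq> m' a" "m (m' a) \<noteq> a" "m (m' a) \<noteq> m a" "m a \<noteq> a"
      using matesD[OF m(1) a(1)] matesD[OF m(1) b(1)] a b by metis+
    then show ?thesis using a b by auto
  qed
  ultimately show ?thesis by (metis card_mono)
qed

lemma outer_classes_eq:
  assumes m: "mates A m"
  shows "outer_classes p (2 * p - 2) G A = (\<lambda>u. {u, m u}) ` (A - core (2 * p - 2) G A)"
proof -
  let ?C = "core (2 * p - 2) G A"
  have A: "A \<subseteq> verts G" "card A = 2 * p" using m by (auto simp: mates_def)
  have classes: "colour_classes p (mate_graph A m') = (\<lambda>u. {u, m' u}) ` A" if "mates A m'" for m'
    using that p3 by (intro colour_classes_mate_graph) (auto simp: mates_def)
  show ?thesis
  proof (intro equalityI subsetI)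
    fix X assume "X \<in> outer_classes p (2 * p - 2) G A"
    then obtain K where K: "K \<in> Kp2s p (induced G A)" "X \<in> colour_classes p K" "\<not> X \<subseteq> ?C"
      unfolding outer_classes_def by blast
    then obtain m' where m': "mates A m'" "X \<in> colour_classes p (mate_graph A m')" "\<not> X \<subseteq> ?C"
      by (auto simp: Kp2s_induced_iff[OF A])
    then obtain u where u: "u \<in> A" "X = {u, m' u}" using classes by auto
    have "u \<notin> ?C" using m' u core_mate[OF m'(1), of u] by auto
    then show "X \<in> (\<lambda>u. {u, m u}) ` (A - ?C)" using u outer_mate_eq[OF m m'(1) u(1)] by auto
  next
    fix X assume "X \<in> (\<lambda>u. {u, m u}) ` (A - ?C)"
    moreover have "mate_graph A m \<in> Kp2s p (induced G A)" using m Kp2s_induced_iff[OF A] by blast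
    ultimately show "X \<in> outer_classes p (2 * p - 2) G A"
      unfolding outer_classes_def using classes[OF m] by blast
  qed
qed

text \<open>The outer classes split the complement of the core into pairs. With a core of size 2k
  there are p - k of them, the capacity of \<open>DenseZ\<close>.\<close>

lemma card_outer_classes:
  assumes m: "mates A m"
  shows "card (core (2 * p - 2) G A) + 2 * card (outer_classes p (2 * p - 2) G A) = 2 * p"
proof -
  let ?C = "core (2 * p - 2) G A" and ?O = "outer_classes p (2 * p - 2) G A"
  have fin: "finite A" by (rule mates_finite[OF m])
  have out: "m u \<in> A - ?C" if "u \<in> A - ?C" for u
    using that core_mate[OF m, of "m u"] matesD[OF m, of u] by auto
  have U: "\<Union>?O = A - ?C" unfolding outer_classes_eq[OF m] using out by auto
  have "2 * card ?O = card (\<Union>?O)"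
  proof (rule card_partition)
    show "finite ?O" unfolding outer_classes_eq[OF m] using fin by simp
    show "finite (\<Union>?O)" unfolding U using fin by simp
    show "card X = 2" if "X \<in> ?O" for X
      using that matesD[OF m] unfolding outer_classes_eq[OF m] by (auto simp: card_2_iff)
    have cls: "X = {x, m x}" if "X \<in> ?O" "x \<in> X" for X x
      using that matesD[OF m] unfolding outer_classes_eq[OF m] by auto
    show "X \<inter> Y = {}" if "X \<in> ?O" "Y \<in> ?O" "X \<noteq> Y" for X Y
    proof (rule ccontr)
      assume "X \<inter> Y \<noteq> {}"
      then obtain x where "x \<in> X" "x \<in> Y" by blast
      then show False using cls that by metis
    qed
  qed
  moreover have "card (A - ?C) + card ?C = card A"
    using fin core_subset[of _ A] by (metis card_Diff_subset card_mono finite_subset le_add_diff_inverse2)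
  ultimately show ?thesis using U mates_card[OF m] by simp
qed

text \<open>Core vertices are adjacent to all other vertices of \<open>A\<close>, so two core
  classes {a, b} and {d, e} may be regrouped into {a, d} and {b, e}.\<close>

lemma dense_rematch:
  assumes m: "mates A m" and ab: "a \<in> core (2 * p - 2) G A" "b = m a"
    and de: "d \<in> core (2 * p - 2) G A" "e = m d" and ne: "d \<noteq> a" "d \<noteq> b"
  shows "mates A (m(a := d, d := a, b := e, e := b))" (is "mates A ?m")
proof -
  let ?C = "core (2 * p - 2) G A"
  have C: "a \<in> ?C" "b \<in> ?C" "d \<in> ?C" "e \<in> ?C" using ab de core_mate[OF m] by auto
  then have inA: "a \<in> A" "b \<in> A" "d \<in> A" "e \<in> A" using core_subset by blast+
  have mm: "m a = b" "m b = a" "m d = e" "m e = d" "a \<noteq> b" "d \<noteq> e"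
    using ab(2) de(2) matesD[OF m inA(1)] matesD[OF m inA(3)] by auto
  then have ne': "e \<noteq> a" "e \<noteq> b" using ne by auto
  have "mating A ?m"
    unfolding mating_def
  proof
    fix u assume u: "u \<in> A"
    have "m u \<noteq> a \<and> m u \<noteq> b \<and> m u \<noteq> d \<and> m u \<noteq> e" if "u \<notin> {a, b, d, e}"
      using that matesD[OF m u] mm by auto
    then show "?m u \<in> A \<and> ?m u \<noteq> u \<and> ?m (?m u) = u"
      using matesD[OF m u] inA mm ne ne' by (cases "u \<in> {a, b, d, e}") auto
  qed
  moreover have "{u, v} \<in> edges G" if "u \<in> A" "v \<in> A" "u \<noteq> v" "v \<noteq> ?m u" for u v
  proof (cases "u \<in> {a, b, d, e}")
    case True
    then show ?thesis using C core_adj[OF m _ that(2,3)] by blast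
  next
    case False
    then show ?thesis using that mates_adj[OF m that(1-3)] by auto
  qed
  ultimately show ?thesis using m unfolding mates_def by blast
qed

text \<open>The neighbours are x, y, z and the 2p - 4 vertices of \<open>W\<close> other than u and
  its mate. Full degree is what forces u to be covered.\<close>

lemma triple_degree:
  assumes T: "triple W m x y z" and u: "u \<in> W"
  shows "degree G u = 2 * p - 1"
proof -
  have T': "x \<notin> W" "y \<notin> W" "z \<notin> W" "x \<noteq> y" "x \<noteq> z" "y \<noteq> z" "mating W m" "card W = 2 * p - 2"
    using T unfolding triple_def by auto
  have fin: "finite W" using T by (rule triple_finite)
  have mu: "m u \<in> W" "m u \<noteq> u" using T'(7) u unfolding mating_def by auto
  let ?S = "insert x (insert y (insert z (W - {u, m u})))"
  have "card (W - {u, m u}) = 2 * p - 4"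
    using mu u fin T' by (subst card_Diff_subset) auto
  then have cS: "card ?S = 2 * p - 1" using fin T' p3 by simp
  have "?S \<subseteq> neighbours G u"
  proof
    fix v assume "v \<in> ?S"
    then have "{u, v} \<in> edges G" using T u unfolding triple_def by auto
    then show "v \<in> neighbours G u" by (simp add: neighbours_def insert_commute)
  qed
  then have "card ?S \<le> card (neighbours G u)" by (rule card_mono[OF finite_neighbours])
  then have "2 * p - 1 \<le> degree G u" using cS by (simp add: degree_eq_card_neighbours)
  moreover have "u \<in> verts G" using T u edge_verts unfolding triple_def by blast
  ultimately show ?thesis using degree_le by (simp add: le_antisym)
qed

section \<open>Finiteness, and edges that hit a copy\<close>

lemma finite_Kp2s: "finite (Kp2s p G)"
proof (rule finite_subset)
  show "Kp2s p G \<subseteq> (\<lambda>(V, E). Graph V E) ` (Pow (verts G) \<times> Pow (edges G))"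
  proof
    fix K assume "K \<in> Kp2s p G"
    moreover have "K = (\<lambda>(V, E). Graph V E) (verts K, edges K)" by simp
    ultimately show "K \<in> (\<lambda>(V, E). Graph V E) ` (Pow (verts G) \<times> Pow (edges G))"
      unfolding Kp2s_def subgraph_def by blast
  qed
qed (simp add: finite_verts finite_edges)

lemma finite_dense_sets: "finite {A. dense_set p G A}"
  by (rule finite_subset[of _ "Pow (verts G)"]) (auto simp: dense_set_def finite_verts)

lemma Kp2s_edge_subset:
  assumes "K \<in> Kp2s p G" "e \<in> edges K"
  shows "e \<subseteq> verts K \<and> e \<noteq> {}"
  using assms by (auto simp: Kp2s_iff elim!: mate_graph_edgeE)

text \<open>At most one of a and b is the mate of c in \<open>K\<close>; the edge from c to the
  other belongs to \<open>K\<close>.\<close>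

lemma star_hits:
  assumes "K \<in> Kp2s p G" "{c, a, b} \<subseteq> verts K" "a \<noteq> c" "b \<noteq> c" "a \<noteq> b" "{{c, a}, {c, b}} \<subseteq> N"
  shows "edges K \<inter> N \<noteq> {}"
proof -
  obtain A m where A: "mates A m" "K = mate_graph A m" using assms(1) by (auto simp: Kp2s_iff)
  then have "{c, a} \<in> edges K \<or> {c, b} \<in> edges K"
    using assms by (auto simp: mates_edge_iff)
  then show ?thesis using assms by blast
qed

end

section \<open>Edge weights, potentials and centers\<close>

locale weighted_graph = bounded_graph +
  fixes w :: "'a set \<Rightarrow> real" and c :: "'a set \<Rightarrow> 'a"
  assumes w_nonneg: "e \<in> edges G \<Longrightarrow> w e \<ge> 0"
    and induced_Kp2s: "K \<in> Kp2s p G \<Longrightarrow> vertex_induced w K"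
    and center_core: "dense_set p G A \<Longrightarrow> c A \<in> core (2 * p - 2) G A"
begin

lemma pot_Kp2:
  assumes "K \<in> Kp2s p G" "{u, v} \<in> edges K"
  shows "w {u, v} = pot w K u + pot w K v"
proof -
  have "potential_function w K (pot w K)"
    unfolding pot_def using induced_Kp2s[OF assms(1)] unfolding vertex_induced_def by (rule someI_ex)
  then show ?thesis using assms(2) unfolding potential_function_def by blast
qed

text \<open>The weights of a triangle determine the potentials of its vertices: 2 r(a) = w(ab) +
  w(ad) - w(bd).\<close>

lemma triangle_pot_eq:
  assumes K: "K \<in> Kp2s p G" "{a, b} \<in> edges K" "{b, d} \<in> edges K" "{a, d} \<in> edges K"
    and K': "K' \<in> Kp2s p G" "{a, b} \<in> edges K'" "{b, d} \<in> edges K'" "{a, d} \<in> edges K'"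
  shows "pot w K a = pot w K' a"
  using K(2-4)[THEN pot_Kp2[OF K(1)]] K'(2-4)[THEN pot_Kp2[OF K'(1)]] by linarith

text \<open>
If $a$ and $b$ are mates in $K$, then some other $K'$ contains the edge $ab$ and shares with $K$ a
triangle through $a$ and one through $b$, so that the potentials of $K$ and $K'$ agree at $a$ and $b$.
\<close>

lemma dense_pot:
  assumes dense: "dense_set p G A" and ab: "{a, b} \<in> edges G" "a \<in> A" "b \<in> A"
  shows "w {a, b} = pot w (induced G A) a + pot w (induced G A) b"
proof -
  let ?C = "core (2 * p - 2) G A"
  obtain m where m: "mates A m" using dense by (auto simp: dense_set_iff)
  define K where "K = mate_graph A m"
  have K: "K \<in> Kp2s p G" unfolding K_def using m by (rule mates_mate_graph)
  have K_edge: "{u, v} \<in> edges K \<longleftrightarrow> u \<in> A \<and> v \<in> A \<and> u \<noteq> v \<and> v \<noteq> m u" for u v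
    unfolding K_def by (rule mates_edge_iff[OF m])
  have "w {a, b} = pot w K a + pot w K b" if ab: "{a, b} \<in> edges G" "a \<in> A" "b \<in> A" for a b
  proof (cases "b = m a")
    case False
    then show ?thesis using ab edge_verts by (intro pot_Kp2[OF K]) (auto simp: K_edge)
  next
    case True
    have aC: "a \<in> ?C" using ab True core_iff[OF m, of a] by simp
    have "card (?C - {a, b}) > 0"
      using card_core_ge[OF dense] diff_card_le_card_Diff[of "{a, b}" ?C]
        card_insert_le_m1[of 2 "{b}" a] by simp
    then obtain d where d: "d \<in> ?C" "d \<noteq> a" "d \<noteq> b" by (auto simp: card_gt_0_iff)
    define e where "e = m d"
    have dA: "d \<in> A" using d core_subset by blast
    have eA: "e \<in> A" "e \<noteq> d" "m e = d" unfolding e_def using matesD[OF m dA] by auto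
    have mb: "m b = a" "a \<noteq> b" using matesD[OF m ab(2)] True by auto
    have ne: "e \<noteq> a" "e \<noteq> b" using eA d True mb by auto
    \<comment> \<open>A fifth vertex exists because 2p >= 6. With it, the triangles a e f and b d f
      lie in both copies.\<close>
    have "card (A - {a, b, d, e}) > 0"
      using mates_card[OF m] p3 diff_card_le_card_Diff[of "{a, b, d, e}" A] card_length[of "[a, b, d, e]"]
      by simp
    then obtain f where f: "f \<in> A" "f \<noteq> a" "f \<noteq> b" "f \<noteq> d" "f \<noteq> e" by (auto simp: card_gt_0_iff)
    define m' where "m' = m(a := d, d := a, b := e, e := b)"
    have m': "mates A m'"
      unfolding m'_def by (rule dense_rematch[OF m aC True d(1) e_def d(2,3)])
    have m'_eq: "m' a = d" "m' d = a" "m' b = e" "m' e = b"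
      unfolding m'_def using d ne mb eA by auto
    define K' where "K' = mate_graph A m'"
    have K': "K' \<in> Kp2s p G" unfolding K'_def using m' by (rule mates_mate_graph)
    have K'_edge: "{u, v} \<in> edges K' \<longleftrightarrow> u \<in> A \<and> v \<in> A \<and> u \<noteq> v \<and> v \<noteq> m' u" for u v
      unfolding K'_def by (rule mates_edge_iff[OF m'])
    have "pot w K a = pot w K' a"
      by (rule triangle_pot_eq[OF K _ _ _ K', of a e f])
        (use ab dA eA f d ne mb True m'_eq in \<open>simp_all add: K_edge K'_edge\<close>)
    moreover have "pot w K b = pot w K' b"
      by (rule triangle_pot_eq[OF K _ _ _ K', of b d f])
        (use ab dA eA f d ne mb True m'_eq e_def in \<open>simp_all add: K_edge K'_edge\<close>)
    moreover have "w {a, b} = pot w K' a + pot w K' b"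
      by (rule pot_Kp2[OF K']) (use ab d mb m'_eq in \<open>simp add: K'_edge\<close>)
    ultimately show ?thesis by simp
  qed
  moreover have "{u, v} \<in> edges (induced G A) \<longleftrightarrow> {u, v} \<in> edges G \<and> u \<in> A \<and> v \<in> A" for u v
    by (auto simp: induced_def)
  \<comment> \<open>\<open>pot w (induced G A)\<close> is an arbitrary choice, so it is a potential
    function as soon as one exists; \<open>pot w K\<close> is such a witness.\<close>
  ultimately have "potential_function w (induced G A) (pot w K)"
    unfolding potential_function_def by blast
  then have "potential_function w (induced G A) (pot w (induced G A))"
    unfolding pot_def[of w "induced G A"] by (intro someI_ex[of "potential_function w (induced G A)"] exI)
  then show ?thesis using ab unfolding potential_function_def induced_def by simp
qed

subsection \<open>Partial covers\<close>

text \<open>What the gadget of \<open>A\<close> pays when both parallel edges at the center are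
  used. The maximum with 0 covers the dense sets without a gadget, whose center potential is
  negative.\<close>

definition credit :: "'a set \<Rightarrow> real" where
  "credit A = max 0 (2 * pot w (induced G A) (c A))"

text \<open>
The set \<open>D\<close> consists of the dense sets that are still to be settled: their centers and their
$K^p_2$'s need not be covered, and their credits have not been spent.
\<close>

definition partial_cover :: "'a set set \<Rightarrow> 'a set set \<Rightarrow> real \<Rightarrow> bool" where
  "partial_cover N D \<beta> \<longleftrightarrow> N \<subseteq> edges G \<and> D \<subseteq> {A. dense_set p G A} \<and>
     (\<forall>v\<in>verts G. degree G v = 2 * p - 1 \<longrightarrow> v \<in> c ` D \<or> (\<exists>e\<in>N. v \<in> e)) \<and>
     (\<forall>K\<in>Kp2s p G. K \<in> problematic_Kp2s p w G \<or> dense_set p G (verts K) \<and> verts K \<notin> D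
        \<longrightarrow> edges K \<inter> N \<noteq> {}) \<and>
     sum w N + sum credit D \<le> \<beta>"

text \<open>Only an inequality, since \<open>F\<close> may overlap \<open>N\<close>; weights are
  nonnegative, so an overlap can only lower the total.\<close>

lemma sum_exchange_le:
  assumes "N \<subseteq> edges G" "e \<in> N" "F \<subseteq> edges G"
  shows "sum w (N - {e} \<union> F) \<le> sum w N - w e + sum w F"
proof -
  have fin: "finite N" "finite F" using assms finite_edges finite_subset by blast+
  have "sum w (N - {e} \<union> F) \<le> sum w (N - {e}) + sum w F"
    using fin assms w_nonneg by (subst sum_Un) (auto intro!: sum_nonneg)
  then show ?thesis using fin assms by (simp add: sum_diff1)
qed

text \<open>The credit of \<open>A\<close> buys two edges at its center, and these hit every copy on
  \<open>A\<close>. All other copies are disjoint from \<open>A\<close> and do not notice the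
  exchange.\<close>

lemma partial_cover_dense_step:
  assumes pc: "partial_cover N (insert A D) \<beta>" and A: "A \<notin> D"
  shows "\<exists>N'. partial_cover N' D \<beta>"
proof -
  let ?C = "core (2 * p - 2) G A" and ?c = "c A"
  have N: "N \<subseteq> edges G" and dense: "dense_set p G A" and D: "D \<subseteq> {A. dense_set p G A}"
    and cov: "\<And>v. v \<in> verts G \<Longrightarrow> degree G v = 2 * p - 1 \<Longrightarrow> v \<in> c ` insert A D \<or> (\<exists>e\<in>N. v \<in> e)"
    and hit: "\<And>K. K \<in> Kp2s p G \<Longrightarrow> K \<in> problematic_Kp2s p w G
        \<or> dense_set p G (verts K) \<and> verts K \<notin> insert A D \<Longrightarrow> edges K \<inter> N \<noteq> {}"
    and weight: "sum w N + sum credit (insert A D) \<le> \<beta>"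
    using pc unfolding partial_cover_def by auto
  obtain m where m: "mates A m" using dense by (auto simp: dense_set_iff)
  have c: "?c \<in> ?C" using center_core[OF dense] .
  then have cA: "?c \<in> A" using core_subset by blast
  have AV: "A \<subseteq> verts G" using m by (simp add: mates_def)
  have finD: "finite D" using D finite_dense_sets finite_subset by blast
  \<comment> \<open>The exemption for centers of \<open>D\<close> cannot apply to d: a dense set
    with a center in \<open>A\<close> equals \<open>A\<close>. The edge covering d stays in
    \<open>A\<close> because d is in the core.\<close>
  have near: "\<exists>x\<in>A. x \<noteq> d \<and> {d, x} \<in> N" if d: "d \<in> ?C" "d \<noteq> ?c" for d
  proof -
    have dA: "d \<in> A" "degree G d = 2 * p - 1" "neighbours G d \<subseteq> A"
      using d p3 unfolding core_def by auto
    have "d \<notin> c ` D"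
    proof
      assume "d \<in> c ` D"
      then obtain B where B: "B \<in> D" "d = c B" by blast
      then have "dense_set p G B" "d \<in> B" using D center_core core_subset by blast+
      then have "A = B"
        using dense_closed[OF _ mates_mate_graph[OF m], of B] dA by auto
      then show False using B A by simp
    qed
    then obtain e where e: "e \<in> N" "d \<in> e" using cov dA d AV by blast
    then obtain x where x: "e = {d, x}" "d \<noteq> x" using N by (metis edge_atE subsetD)
    have dx: "{d, x} \<in> N" using x e by simp
    then have "{x, d} \<in> edges G" using N by (auto simp: insert_commute)
    then have "x \<in> A" using dA by (auto simp: neighbours_def)
    then show ?thesis using x dx by auto
  qed
  \<comment> \<open>The condition on \<open>N - N'\<close> says that a removed edge has both ends
    among a and b, so the new edges at the center keep these covered.\<close>
  obtain N' a b where N': "N' \<subseteq> edges G" and ab: "a \<in> A" "b \<in> A" "a \<noteq> ?c" "b \<noteq> ?c" "a \<noteq> b"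
    and star: "{{?c, a}, {?c, b}} \<subseteq> N'" and old: "\<And>e. e \<in> N - N' \<Longrightarrow> e \<subseteq> {a, b}"
    and weight': "sum w N' \<le> sum w N + credit A"
  proof (cases "\<exists>e\<in>N. e \<subseteq> A \<and> ?c \<notin> e")
    case True
    then obtain e where e: "e \<in> N" "e \<subseteq> A" "?c \<notin> e" by blast
    then obtain a b where ab: "e = {a, b}" "a \<noteq> b" using N by (metis edgeE subsetD)
    let ?F = "{{?c, a}, {?c, b}}"
    have ab': "a \<in> A" "b \<in> A" "a \<noteq> ?c" "b \<noteq> ?c" using e ab by auto
    have F: "{?c, a} \<in> edges G" "{?c, b} \<in> edges G"
      using core_adj[OF m c] ab' by auto
    have "sum w ?F = w {?c, a} + w {?c, b}" using ab by (simp add: doubleton_eq_iff)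
    \<comment> \<open>By \<open>dense_pot\<close> all three edges are sums of the same potentials,
      so the exchange costs exactly twice the center potential.\<close>
    also have "\<dots> = w e + 2 * pot w (induced G A) ?c"
      using dense_pot[OF dense] F ab' cA ab e N by (auto simp: subset_eq)
    finally have "sum w (N - {e} \<union> ?F) \<le> sum w N + credit A"
      using sum_exchange_le[OF N e(1), of ?F] F unfolding credit_def by simp
    moreover have "N - {e} \<union> ?F \<subseteq> edges G" using N F by blast
    moreover have "x \<subseteq> {a, b}" if "x \<in> N - (N - {e} \<union> ?F)" for x using that ab(1) by blast
    ultimately show thesis using ab(2) ab' by (intro that[of "N - {e} \<union> ?F" a b]) blast+
  next
    case False
    have "card (?C - {?c}) \<ge> 2" using card_core_ge[OF dense] c by simp
    then obtain S where "S \<subseteq> ?C - {?c}" "card S = 2"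
      by (meson obtain_subset_with_card_n)
    then obtain a b where ab: "a \<in> ?C" "b \<in> ?C" "a \<noteq> ?c" "b \<noteq> ?c" "a \<noteq> b"
      by (auto simp: card_2_iff)
    \<comment> \<open>Here no edge of \<open>N\<close> inside \<open>A\<close> avoids the center, so
      the edge provided by \<open>near\<close> ends there.\<close>
    have "{?c, d} \<in> N" if d: "d \<in> ?C" "d \<noteq> ?c" for d
    proof -
      obtain x where x: "x \<in> A" "x \<noteq> d" "{d, x} \<in> N" using near[OF d] by blast
      have "d \<in> A" using d core_subset by blast
      then have "?c \<in> {d, x}" using False x by (metis empty_subsetI insert_subset)
      then show ?thesis using x d by (auto simp: insert_commute)
    qed
    moreover have "a \<in> A" "b \<in> A" using ab core_subset by blast+
    moreover have "0 \<le> credit A" by (simp add: credit_def)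
    ultimately show thesis
      using N ab by (intro that[of N a b]) auto
  qed
  have "partial_cover N' D \<beta>"
    unfolding partial_cover_def
  proof (intro conjI ballI impI N' D)
    fix v assume "v \<in> verts G" "degree G v = 2 * p - 1"
    then consider "v = ?c" | "v \<in> c ` D" | e where "e \<in> N" "v \<in> e" using cov by blast
    then show "v \<in> c ` D \<or> (\<exists>e\<in>N'. v \<in> e)"
    proof cases
      case 3
      then show ?thesis using old[of e] star by (cases "e \<in> N'") auto
    qed (use star in auto)
  next
    fix K assume K: "K \<in> Kp2s p G"
      and K': "K \<in> problematic_Kp2s p w G \<or> dense_set p G (verts K) \<and> verts K \<notin> D"
    show "edges K \<inter> N' \<noteq> {}"
    proof (cases "verts K = A")
      case True
      then show ?thesis using K cA ab star by (intro star_hits[of K ?c a b]) auto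
    next
      case False
      then obtain e where e: "e \<in> edges K" "e \<in> N" using hit[OF K] K' by blast
      have "e \<in> N'"
      proof (rule ccontr)
        assume "e \<notin> N'"
        then have "A \<inter> verts K \<noteq> {}" using old[of e] e Kp2s_edge_subset[OF K e(1)] ab by blast
        then show False using dense_closed[OF dense K] False by simp
      qed
      then show ?thesis using e by blast
    qed
  next
    show "sum w N' + sum credit D \<le> \<beta>" using weight weight' A finD by simp
  qed
  then show ?thesis by blast
qed

lemma partial_cover_no_dense:
  assumes "partial_cover N D \<beta>"
  shows "\<exists>N'. partial_cover N' {} \<beta>"
proof -
  have "finite D" using assms finite_dense_sets finite_subset unfolding partial_cover_def by blast
  then show ?thesis using assms
  proof (induction D arbitrary: N)
    case (insert A D)
    then show ?case using partial_cover_dense_step by blast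
  qed blast
qed

text \<open>One exchange of \<open>ux\<close> for \<open>uy\<close> inside a triple. No copy that
  was hit is lost, which makes the iteration terminate.\<close>

lemma partial_cover_triple_step:
  assumes pc: "partial_cover N {} \<beta>" and K: "K \<in> Kp2s p G" and unhit: "edges K \<inter> N = {}"
  shows "\<exists>N'. partial_cover N' {} \<beta> \<and> edges K \<inter> N' \<noteq> {} \<and>
    (\<forall>L\<in>Kp2s p G. edges L \<inter> N \<noteq> {} \<longrightarrow> edges L \<inter> N' \<noteq> {})"
proof -
  have N: "N \<subseteq> edges G"
    and cov: "\<And>v. v \<in> verts G \<Longrightarrow> degree G v = 2 * p - 1 \<Longrightarrow> \<exists>e\<in>N. v \<in> e"
    and hit: "\<And>K. K \<in> Kp2s p G \<Longrightarrow> K \<in> problematic_Kp2s p w G \<or> dense_set p G (verts K)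
        \<Longrightarrow> edges K \<inter> N \<noteq> {}"
    and weight: "sum w N \<le> \<beta>"
    using pc unfolding partial_cover_def by auto
  have "unproblematic p w G K" "\<not> dense_set p G (verts K)"
    using hit[OF K] unhit K unfolding problematic_Kp2s_def by blast+
  then obtain K' where K': "K' \<in> Kp2s p G" "K' \<noteq> K" "verts K \<inter> verts K' \<noteq> {}"
      and le: "sum w (edges K) \<le> sum w (edges K')" and nd: "\<not> dense_set p G (verts K)"
    unfolding unproblematic_def by blast
  obtain A m\<^sub>1 A' m\<^sub>2 where A: "mates A m\<^sub>1" "K = mate_graph A m\<^sub>1" "mates A' m\<^sub>2" "K' = mate_graph A' m\<^sub>2"
    using K K'(1) by (auto simp: Kp2s_iff)
  \<comment> \<open>Two different copies on one vertex set would make it dense, and copies on dense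
    sets are already hit.\<close>
  have "A \<noteq> A'"
  proof
    assume "A = A'"
    then have "dense_set p G A" using A K'(2) dense_set_iff by blast
    then show False using nd A by simp
  qed
  then obtain W m x y z where T: "triple W m x y z" and KT: "K = pair_graph W m y z" "K' = pair_graph W m x z"
    using share_triple[OF A(1,3)] K'(3) A by (metis disjoint_iff verts_mate_graph)
  have T': "x \<notin> W" "y \<notin> W" "z \<notin> W" "x \<noteq> y" "x \<noteq> z" "y \<noteq> z" "mating W m" "card W = 2 * p - 2"
    "\<And>u. u \<in> W \<Longrightarrow> {u, x} \<in> edges G \<and> {u, y} \<in> edges G \<and> {u, z} \<in> edges G"
    using T unfolding triple_def by auto
  have fin: "finite W" using T by (rule triple_finite)
  have E: "edges (pair_graph W m a b) = edges (mate_graph W m) \<union> (\<lambda>u. {u, a}) ` W \<union> (\<lambda>u. {u, b}) ` W"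
    if "a \<notin> W" "b \<notin> W" "a \<noteq> b" for a b
    using edges_pair_graph T' that by metis
  \<comment> \<open>By full degree u is covered by \<open>N\<close>. Every edge at u other than
    \<open>ux\<close> belongs to \<open>K\<close>, which \<open>N\<close> misses.\<close>
  have xN: "{u, x} \<in> N" if u: "u \<in> W" for u
  proof -
    have "u \<in> verts G" using T'(9)[OF u] edge_verts by blast
    then obtain e where e: "e \<in> N" "u \<in> e" using cov triple_degree[OF T u] by blast
    then obtain v where v: "e = {u, v}" "u \<noteq> v" using N by (metis edge_atE subsetD)
    then have "v \<in> W \<union> {x, y, z}" "v \<noteq> m u" using triple_neighbour[OF T u, of v] e N by auto
    moreover have "e \<notin> edges K" using e unhit by blast
    then have "e \<notin> edges (mate_graph W m)" "v \<noteq> y" "v \<noteq> z"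
      using v u T' unfolding KT E[OF T'(2,3,6)] by auto
    ultimately have "v = x" using v u by (auto simp: mate_graph_edge_iff[OF T'(7)])
    then show ?thesis using e v by simp
  qed
  have inj: "inj_on (\<lambda>u. {u, a}) W" for a by (auto simp: inj_on_def doubleton_eq_iff)
  have sums: "sum w (edges (pair_graph W m a b))
      = sum w (edges (mate_graph W m)) + (\<Sum>u\<in>W. w {u, a}) + (\<Sum>u\<in>W. w {u, b})"
    if ab: "a \<notin> W" "b \<notin> W" "a \<noteq> b" for a b
  proof -
    have "edges (mate_graph W m) \<subseteq> Pow W" by (auto simp: mate_graph_def)
    then have finW: "finite (edges (mate_graph W m))" using fin finite_subset by blast
    have d: "edges (mate_graph W m) \<inter> (\<lambda>u. {u, a}) ` W = {}"
      "(edges (mate_graph W m) \<union> (\<lambda>u. {u, a}) ` W) \<inter> (\<lambda>u. {u, b}) ` W = {}"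
      using ab \<open>edges (mate_graph W m) \<subseteq> Pow W\<close> by (auto simp: doubleton_eq_iff)
    show ?thesis unfolding E[OF ab]
      using d fin finW by (simp add: sum.union_disjoint sum.reindex[OF inj])
  qed
  \<comment> \<open>The edges inside \<open>W\<close> and those to z occur in both copies and cancel
    in the comparison of their weights. Some single u must then satisfy the inequality.\<close>
  have "(\<Sum>u\<in>W. w {u, y}) \<le> (\<Sum>u\<in>W. w {u, x})"
    using le T' unfolding KT by (simp add: sums)
  then obtain u where u: "u \<in> W" "w {u, y} \<le> w {u, x}"
    using sum_strict_mono[OF fin triple_nonempty[OF T], of "\<lambda>u. w {u, x}" "\<lambda>u. w {u, y}"]
    by (meson leD leI)
  have "W - {u} \<noteq> {}"
  proof
    assume "W - {u} = {}"
    then have "card W \<le> card {u}" by (intro card_mono) auto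
    then show False using T'(8) p3 by simp
  qed
  \<comment> \<open>The edge from u' to x survives the exchange, so it keeps x covered and hits the
    two copies containing x.\<close>
  then obtain u' where u': "u' \<in> W" "u' \<noteq> u" by blast
  define N' where "N' = N - {{u, x}} \<union> {{u, y}}"
  have N': "N' \<subseteq> edges G" using N T'(9)[OF u(1)] unfolding N'_def by auto
  have in': "{u, y} \<in> N'" "{u', x} \<in> N'"
    using xN[OF u'(1)] u' T' u unfolding N'_def by (auto simp: doubleton_eq_iff)
  \<comment> \<open>Each of the three copies of the triple contains y and hence \<open>uy\<close>,
    or contains x and hence the edge from u' to x.\<close>
  have hit_near: "edges L \<inter> N' \<noteq> {}" if L: "L \<in> Kp2s p G" "verts L \<inter> (W \<union> {x, y, z}) \<noteq> {}" for L
  proof -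
    consider "L = pair_graph W m x y" | "L = pair_graph W m x z" | "L = pair_graph W m y z"
      using triple_Kp2s[OF T L] by blast
    then have "{u, y} \<in> edges L \<or> {u', x} \<in> edges L"
      using u u' T' by cases (simp_all add: E)
    then show ?thesis using in' by blast
  qed
  have hit': "edges L \<inter> N' \<noteq> {}" if L: "L \<in> Kp2s p G" "edges L \<inter> N \<noteq> {}" for L
  proof -
    obtain e where e: "e \<in> edges L" "e \<in> N" using L by blast
    show ?thesis
    proof (cases "e = {u, x}")
      case True
      then have "x \<in> verts L" using Kp2s_edge_subset[OF L(1) e(1)] by blast
      then show ?thesis by (intro hit_near L) auto
    next
      case False
      then show ?thesis using e unfolding N'_def by blast
    qed
  qed
  have "sum w N' \<le> sum w N - w {u, x} + w {u, y}"
    unfolding N'_def using sum_exchange_le[OF N xN[OF u(1)], of "{{u, y}}"] T'(9)[OF u(1)] by simp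
  then have "sum w N' \<le> \<beta>" using u weight by linarith
  moreover have "\<exists>e\<in>N'. v \<in> e" if v: "v \<in> verts G" "degree G v = 2 * p - 1" for v
  proof -
    obtain e where e: "e \<in> N" "v \<in> e" using cov v by blast
    show ?thesis
    proof (cases "e = {u, x}")
      case True
      then show ?thesis using e in' by blast
    next
      case False
      then show ?thesis using e unfolding N'_def by blast
    qed
  qed
  ultimately have "partial_cover N' {} \<beta>"
    using N' hit hit' unfolding partial_cover_def by simp
  moreover have "edges K \<inter> N' \<noteq> {}" by (rule hit_near[OF K]) (simp add: KT)
  ultimately show ?thesis using hit' by blast
qed

lemma partial_cover_complete:
  assumes "partial_cover N {} \<beta>"
  shows "\<exists>N'. partial_cover N' {} \<beta> \<and> (\<forall>K\<in>Kp2s p G. edges K \<inter> N' \<noteq> {})"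
  using assms
proof (induction "card {K \<in> Kp2s p G. edges K \<inter> N = {}}" arbitrary: N rule: less_induct)
  case less
  show ?case
  proof (cases "\<forall>K\<in>Kp2s p G. edges K \<inter> N \<noteq> {}")
    case True
    then show ?thesis using less by blast
  next
    case False
    then obtain K where K: "K \<in> Kp2s p G" "edges K \<inter> N = {}" by blast
    obtain N' where N': "partial_cover N' {} \<beta>" "edges K \<inter> N' \<noteq> {}"
        "\<And>L. L \<in> Kp2s p G \<Longrightarrow> edges L \<inter> N \<noteq> {} \<Longrightarrow> edges L \<inter> N' \<noteq> {}"
      using partial_cover_triple_step[OF less.prems K] by blast
    have "{L \<in> Kp2s p G. edges L \<inter> N' = {}} \<subset> {L \<in> Kp2s p G. edges L \<inter> N = {}}"
      using K N' by blast
    then have "card {L \<in> Kp2s p G. edges L \<inter> N' = {}} < card {L \<in> Kp2s p G. edges L \<inter> N = {}}"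
      using finite_Kp2s by (intro psubset_card_mono) auto
    then show ?thesis using less.hyps N'(1) by blast
  qed
qed

lemma partial_cover_covering:
  assumes "partial_cover N {} \<beta>" "\<forall>K\<in>Kp2s p G. edges K \<inter> N \<noteq> {}"
  shows "Kp2_covering_co_t_matching p (2 * p - 2) G N"
proof -
  have N: "N \<subseteq> edges G" and cov: "\<And>v. v \<in> verts G \<Longrightarrow> degree G v = 2 * p - 1 \<Longrightarrow> \<exists>e\<in>N. v \<in> e"
    using assms unfolding partial_cover_def by auto
  have "deg_in (edges G - N) v \<le> 2 * p - 2" if v: "v \<in> verts G" for v
  proof (cases "degree G v = 2 * p - 1")
    case False
    have "deg_in (edges G - N) v \<le> degree G v"
      unfolding deg_in_def using finite_edges by (intro card_mono) auto
    then show ?thesis using False degree_le[OF v] by linarith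
  next
    case True
    then obtain e where "e \<in> N" "v \<in> e" using cov v by blast
    then have "deg_in (edges G - N) v < degree G v"
      unfolding deg_in_def using finite_edges N by (intro psubset_card_mono) auto
    then show ?thesis using True by linarith
  qed
  then show ?thesis
    using N assms(2)
    unfolding Kp2_covering_co_t_matching_def co_t_matching_def t_matching_def by blast
qed

end

subsection \<open>Gadgets\<close>

text \<open>Assigning auxiliary edges to their gadgets lets the weight of a matching split into
  original edges and one sum per gadget.\<close>

fun prob_gadget_of :: "'a xedge \<Rightarrow> 'a graph option" where
  "prob_gadget_of (ProbVU H X v) = Some H"
| "prob_gadget_of (ProbUZ H X) = Some H"
| "prob_gadget_of _ = None"

fun dense_gadget_of :: "'a xedge \<Rightarrow> 'a set option" where
  "dense_gadget_of (DenseVU A X v) = Some A"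
| "dense_gadget_of (DenseUZ A X) = Some A"
| "dense_gadget_of (CenterC A i) = Some A"
| "dense_gadget_of (DenseCZ A i) = Some A"
| "dense_gadget_of _ = None"

text \<open>Here \<open>vu X v\<close> and \<open>uz X\<close> stand for the edges $(v, u^i)$ and $(u^i, z)$ of a gadget with $X = V_i$.\<close>

lemma class_gadget:
  fixes vu :: "'b set \<Rightarrow> 'b \<Rightarrow> 'e" and uz :: "'b set \<Rightarrow> 'e"
  assumes fin: "finite P"
    and one: "\<And>X. X \<in> P \<Longrightarrow> card {e \<in> M. (\<exists>v\<in>X. e = vu X v) \<or> e = uz X} = 1"
    and inj: "\<And>X v Y u. vu X v = vu Y u \<Longrightarrow> X = Y \<and> v = u" "\<And>X v Y. vu X v \<noteq> uz Y"
  obtains Q f where "Q \<subseteq> P" "card Q + card {X \<in> P. uz X \<in> M} = card P"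
    "\<And>X. X \<in> Q \<Longrightarrow> f X \<in> X"
    "{e \<in> M. \<exists>X\<in>P. \<exists>v\<in>X. e = vu X v} = (\<lambda>X. vu X (f X)) ` Q"
proof -
  \<comment> \<open>In these classes u^i is not matched to z, so its single edge leads to a vertex
    of the class; \<open>f\<close> picks this vertex.\<close>
  define Q where "Q = {X \<in> P. uz X \<notin> M}"
  have "\<exists>v. v \<in> X \<and> vu X v \<in> M \<and> (\<forall>u\<in>X. vu X u \<in> M \<longrightarrow> u = v)" if X: "X \<in> Q" for X
  proof -
    obtain e where e: "{e \<in> M. (\<exists>v\<in>X. e = vu X v) \<or> e = uz X} = {e}"
      using one[of X] X card_1_singletonE unfolding Q_def by blast
    then have "e \<in> {e \<in> M. (\<exists>v\<in>X. e = vu X v) \<or> e = uz X}" by simp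
    then obtain v where v: "v \<in> X" "e = vu X v" "vu X v \<in> M" using X unfolding Q_def by auto
    have "u = v" if "u \<in> X" "vu X u \<in> M" for u
    proof -
      have "vu X u \<in> {e \<in> M. (\<exists>v\<in>X. e = vu X v) \<or> e = uz X}" using that by blast
      then have "vu X u = vu X v" unfolding e v by simp
      then show ?thesis using inj(1) by blast
    qed
    then show ?thesis using v by blast
  qed
  then obtain f where f: "\<And>X. X \<in> Q \<Longrightarrow> f X \<in> X \<and> vu X (f X) \<in> M \<and> (\<forall>u\<in>X. vu X u \<in> M \<longrightarrow> u = f X)"
    by metis
  have out: "X \<in> Q" if X: "X \<in> P" "v \<in> X" "vu X v \<in> M" for X v
  proof (rule ccontr)
    assume "X \<notin> Q"
    then have "{vu X v, uz X} \<subseteq> {e \<in> M. (\<exists>v\<in>X. e = vu X v) \<or> e = uz X}"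
      using X unfolding Q_def by blast
    moreover have "finite {e \<in> M. (\<exists>v\<in>X. e = vu X v) \<or> e = uz X}"
      using one[OF X(1)] by (intro card_ge_0_finite) simp
    ultimately have "card {vu X v, uz X} \<le> 1"
      unfolding one[OF X(1), symmetric] by (rule card_mono[rotated])
    then show False using inj(2) by simp
  qed
  show thesis
  proof
    show "Q \<subseteq> P" by (auto simp: Q_def)
    have "P = Q \<union> {X \<in> P. uz X \<in> M}" "Q \<inter> {X \<in> P. uz X \<in> M} = {}" by (auto simp: Q_def)
    then show "card Q + card {X \<in> P. uz X \<in> M} = card P"
      using fin card_Un_disjoint[of Q "{X \<in> P. uz X \<in> M}"] by (simp add: Q_def)
    show "f X \<in> X" if "X \<in> Q" for X using f that by blast
    show "{e \<in> M. \<exists>X\<in>P. \<exists>v\<in>X. e = vu X v} = (\<lambda>X. vu X (f X)) ` Q"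
    proof (intro equalityI subsetI)
      fix e assume "e \<in> {e \<in> M. \<exists>X\<in>P. \<exists>v\<in>X. e = vu X v}"
      then obtain X v where "X \<in> P" "v \<in> X" "e = vu X v" "e \<in> M" by blast
      then show "e \<in> (\<lambda>X. vu X (f X)) ` Q" using out f by blast
    next
      fix e assume "e \<in> (\<lambda>X. vu X (f X)) ` Q"
      then show "e \<in> {e \<in> M. \<exists>X\<in>P. \<exists>v\<in>X. e = vu X v}" using f unfolding Q_def by blast
    qed
  qed
qed

section \<open>Edges of the auxiliary multigraph\<close>

context weighted_graph
begin

abbreviation "XV \<equiv> xverts p (2 * p - 2) w G c"
abbreviation "XE \<equiv> xedges p (2 * p - 2) w G c"
abbreviation "xw \<equiv> xweight w G c"
abbreviation "prob \<equiv> problematic_Kp2s p w G"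
abbreviation "nonneg \<equiv> nonneg_dense_sets p w G c"
abbreviation "outer \<equiv> outer_classes p (2 * p - 2) G"

lemma nonneg_dense: "A \<in> nonneg \<Longrightarrow> dense_set p G A"
  by (simp add: nonneg_dense_sets_def)

lemma prob_Kp2s: "H \<in> prob \<Longrightarrow> H \<in> Kp2s p G"
  by (simp add: problematic_Kp2s_def)

lemma colour_classes_Kp2s:
  assumes "H \<in> Kp2s p G"
  obtains m where "mates (verts H) m" "H = mate_graph (verts H) m"
    "colour_classes p H = (\<lambda>u. {u, m u}) ` verts H"
proof -
  obtain A m where A: "mates A m" "H = mate_graph A m" using assms by (auto simp: Kp2s_iff)
  then have "colour_classes p H = (\<lambda>u. {u, m u}) ` A"
    using p3 colour_classes_mate_graph[of A m p] by (auto simp: mates_def)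
  then show thesis using A by (intro that[of m]) auto
qed

lemma outer_class_mate:
  assumes "mates A m" "X \<in> outer A" "v \<in> X"
  shows "v \<in> A" "v \<notin> core (2 * p - 2) G A" "X = {v, m v}"
proof -
  obtain u where u: "u \<in> A" "u \<notin> core (2 * p - 2) G A" "X = {u, m u}"
    using assms(2) unfolding outer_classes_eq[OF assms(1)] by blast
  then show "v \<in> A" "v \<notin> core (2 * p - 2) G A" "X = {v, m v}"
    using assms(3) matesD[OF assms(1) u(1)] core_mate[OF assms(1), of "m u"] by auto
qed

lemma xedges_iff:
  "OrigE e \<in> XE \<longleftrightarrow> e \<in> edges G"
  "ProbVU H X v \<in> XE \<longleftrightarrow> H \<in> prob \<and> X \<in> colour_classes p H \<and> v \<in> X"
  "ProbUZ H X \<in> XE \<longleftrightarrow> H \<in> prob \<and> X \<in> colour_classes p H"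
  "DenseVU A X v \<in> XE \<longleftrightarrow> A \<in> nonneg \<and> X \<in> outer A \<and> v \<in> X"
  "DenseUZ A X \<in> XE \<longleftrightarrow> A \<in> nonneg \<and> X \<in> outer A"
  "CenterC A i \<in> XE \<longleftrightarrow> A \<in> nonneg"
  "DenseCZ A i \<in> XE \<longleftrightarrow> A \<in> nonneg"
  by (auto simp: xedges_def)

text \<open>Guards against the value 0 that \<open>sum\<close> and \<open>card\<close> take on
  infinite sets.\<close>

lemma finite_xedges: "finite XE"
proof -
  have K: "finite (verts H)" "finite (colour_classes p H)" "\<Union>(colour_classes p H) \<subseteq> verts H"
    if "H \<in> Kp2s p G" for H
    using that by (auto elim!: colour_classes_Kp2s dest: mates_finite matesD(1))
  have D: "finite A" "finite (outer A)" "\<Union>(outer A) \<subseteq> A" if "dense_set p G A" for A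
    using that by (auto simp: dense_set_iff outer_classes_eq dest: mates_finite matesD(1) outer_class_mate(1))
  have fin: "finite prob" "finite nonneg"
    using finite_Kp2s finite_dense_sets by (simp_all add: problematic_Kp2s_def nonneg_dense_sets_def)
  let ?U = "OrigE ` edges G
     \<union> (\<Union>H\<in>prob. (\<Union>X\<in>colour_classes p H. ProbVU H X ` verts H) \<union> ProbUZ H ` colour_classes p H)
     \<union> (\<Union>A\<in>nonneg. (\<Union>X\<in>outer A. DenseVU A X ` A) \<union> DenseUZ A ` outer A
          \<union> CenterC A ` UNIV \<union> DenseCZ A ` UNIV)"
  have "XE \<subseteq> ?U"
  proof
    fix x assume x: "x \<in> XE"
    show "x \<in> ?U"
    proof (cases x)
      case (ProbVU H X v)
      then have "H \<in> prob" "X \<in> colour_classes p H" "v \<in> X" using x by (simp_all add: xedges_iff)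
      moreover from this have "v \<in> verts H" using K(3)[OF prob_Kp2s] by blast
      ultimately show ?thesis using ProbVU by blast
    next
      case (DenseVU A X v)
      then have "A \<in> nonneg" "X \<in> outer A" "v \<in> X" using x by (simp_all add: xedges_iff)
      moreover from this have "v \<in> A" using D(3)[OF nonneg_dense] by blast
      ultimately show ?thesis using DenseVU by blast
    next
      case (CenterC A i)
      then have "A \<in> nonneg" using x by (simp add: xedges_iff)
      then show ?thesis unfolding CenterC by (intro UnI2[OF UN_I[of A]]) auto
    next
      case (DenseCZ A i)
      then have "A \<in> nonneg" using x by (simp add: xedges_iff)
      then show ?thesis unfolding DenseCZ by (intro UnI2 UN_I[of A]) auto
    qed (use x in \<open>auto simp: xedges_iff\<close>)
  qed
  moreover have "finite ?U"
    using fin K(1,2)[OF prob_Kp2s] D(1,2)[OF nonneg_dense] finite_edges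
    by (intro finite_UnI finite_UN_I finite_imageI) auto
  ultimately show ?thesis by (rule finite_subset)
qed

end

section \<open>Reading edges of the graph off the gadgets\<close>

locale gadget_matching = weighted_graph +
  fixes M :: "'a xedge set"
  assumes matching: "lb_matching (xgraph p (2 * p - 2) w G c) (lower p (2 * p - 2) G)
    (upper p (2 * p - 2) G) M"
begin

lemma M_sub: "M \<subseteq> XE"
  using matching by (simp add: lb_matching_def xgraph_def)

lemma M_finite: "finite M"
  using M_sub finite_xedges finite_subset by blast

lemma M_bounds:
  assumes "x \<in> XV"
  shows "lower p (2 * p - 2) G x \<le> card {e \<in> M. x \<in> xends c e}"
    "card {e \<in> M. x \<in> xends c e} \<le> upper p (2 * p - 2) G x"
  using matching assms by (simp_all add: lb_matching_def xgraph_def)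

lemmas M_memD = subsetD[OF M_sub, THEN xedges_iff(1)[THEN iffD1]]
  subsetD[OF M_sub, THEN xedges_iff(2)[THEN iffD1]] subsetD[OF M_sub, THEN xedges_iff(3)[THEN iffD1]]
  subsetD[OF M_sub, THEN xedges_iff(4)[THEN iffD1]] subsetD[OF M_sub, THEN xedges_iff(5)[THEN iffD1]]
  subsetD[OF M_sub, THEN xedges_iff(6)[THEN iffD1]] subsetD[OF M_sub, THEN xedges_iff(7)[THEN iffD1]]

text \<open>The vertex z absorbs p - 2 of the p class vertices. The other two are matched to
  vertices of different classes; these are joined by an edge of \<open>H\<close>, whose weight is
  the sum of the two potentials paid.\<close>

lemma prob_gadget:
  assumes H: "H \<in> prob"
  obtains e where "e \<in> edges H" "sum xw {x \<in> M. prob_gadget_of x = Some H} = w e"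
    "\<And>X v. ProbVU H X v \<in> M \<Longrightarrow> v \<in> e"
proof -
  have HK: "H \<in> Kp2s p G" using H by (rule prob_Kp2s)
  let ?P = "colour_classes p H"
  obtain m where m: "mates (verts H) m" "H = mate_graph (verts H) m"
    and P: "?P = (\<lambda>u. {u, m u}) ` verts H"
    using HK by (rule colour_classes_Kp2s)
  have "Kp2_classes p H ?P"
    using Kp2_classes_mate_graph[of "verts H" m p] m p3 P by (simp add: mates_def)
  then have cP: "card ?P = p" "finite ?P" by (auto simp: Kp2_classes_def)
  have one: "card {e \<in> M. (\<exists>v\<in>X. e = ProbVU H X v) \<or> e = ProbUZ H X} = 1" if X: "X \<in> ?P" for X
  proof -
    have "ProbU H X \<in> XV" using H X by (auto simp: xverts_def)
    then have "card {e \<in> M. ProbU H X \<in> xends c e} = 1"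
      using M_bounds[of "ProbU H X"] by simp
    moreover have "x \<in> {e \<in> M. ProbU H X \<in> xends c e} \<longleftrightarrow>
        x \<in> {e \<in> M. (\<exists>v\<in>X. e = ProbVU H X v) \<or> e = ProbUZ H X}" for x
      by (cases x) (auto dest: M_memD)
    then have "{e \<in> M. ProbU H X \<in> xends c e}
        = {e \<in> M. (\<exists>v\<in>X. e = ProbVU H X v) \<or> e = ProbUZ H X}" by blast
    ultimately show ?thesis by simp
  qed
  obtain Q f where Q: "Q \<subseteq> ?P" "card Q + card {X \<in> ?P. ProbUZ H X \<in> M} = card ?P"
      "\<And>X. X \<in> Q \<Longrightarrow> f X \<in> X"
    and VU: "{e \<in> M. \<exists>X\<in>?P. \<exists>v\<in>X. e = ProbVU H X v} = (\<lambda>X. ProbVU H X (f X)) ` Q"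
    using class_gadget[of ?P M "ProbVU H" "ProbUZ H"] cP(2) one by auto
  have "ProbZ H \<in> XV" using H by (auto simp: xverts_def)
  then have "card {e \<in> M. ProbZ H \<in> xends c e} = p - 2" using M_bounds[of "ProbZ H"] by simp
  moreover have "x \<in> {e \<in> M. ProbZ H \<in> xends c e} \<longleftrightarrow> x \<in> ProbUZ H ` {X \<in> ?P. ProbUZ H X \<in> M}" for x
    by (cases x) (auto dest: M_memD)
  then have "{e \<in> M. ProbZ H \<in> xends c e} = ProbUZ H ` {X \<in> ?P. ProbUZ H X \<in> M}" by blast
  moreover have "inj_on (ProbUZ H) {X \<in> ?P. ProbUZ H X \<in> M}" by (auto simp: inj_on_def)
  ultimately have "card Q = 2" using Q(2) cP p3 by (simp add: card_image)
  then obtain X Y where XY: "Q = {X, Y}" "X \<noteq> Y" by (auto simp: card_2_iff)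
  have fH: "f X \<in> verts H \<and> X = {f X, m (f X)}" if X: "X \<in> Q" for X
  proof -
    have "X \<in> (\<lambda>u. {u, m u}) ` verts H" using X Q(1) unfolding P by blast
    then obtain u where u: "u \<in> verts H" "X = {u, m u}" by blast
    then show ?thesis using Q(3)[OF X] matesD[OF m(1) u(1)] by auto
  qed
  have inH: "f X \<in> verts H" "f Y \<in> verts H" "X = {f X, m (f X)}" "Y = {f Y, m (f Y)}"
    using fH XY by blast+
  have "f X \<noteq> f Y" "f Y \<noteq> m (f X)"
    using inH XY(2) matesD(3)[OF m(1)] by (metis insert_commute)+
  then have "{f X, f Y} \<in> edges (mate_graph (verts H) m)"
    using inH(1,2) by (simp add: mates_edge_iff[OF m(1)])
  then have e: "{f X, f Y} \<in> edges H" by (simp add: m(2)[symmetric])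
  have "sum xw {x \<in> M. prob_gadget_of x = Some H} = sum xw ((\<lambda>X. ProbVU H X (f X)) ` Q)"
    unfolding VU[symmetric]
  proof (rule sum.mono_neutral_right)
    show "\<forall>x\<in>{x \<in> M. prob_gadget_of x = Some H} - {e \<in> M. \<exists>X\<in>?P. \<exists>v\<in>X. e = ProbVU H X v}. xw x = 0"
    proof
      fix x assume "x \<in> {x \<in> M. prob_gadget_of x = Some H} - {e \<in> M. \<exists>X\<in>?P. \<exists>v\<in>X. e = ProbVU H X v}"
      then show "xw x = 0" by (cases x) (auto dest: M_memD)
    qed
  qed (use M_finite in auto)
  also have "\<dots> = pot w H (f X) + pot w H (f Y)"
    unfolding XY(1) using XY(2) by simp
  also have "\<dots> = w {f X, f Y}" using pot_Kp2[OF HK e] by simp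
  finally have "sum xw {x \<in> M. prob_gadget_of x = Some H} = w {f X, f Y}" .
  moreover have "v \<in> {f X, f Y}" if "ProbVU H Z v \<in> M" for Z v
  proof -
    have "ProbVU H Z v \<in> {e \<in> M. \<exists>X\<in>?P. \<exists>v\<in>X. e = ProbVU H X v}"
      using that by (auto dest: M_memD)
    then show ?thesis unfolding VU XY(1) by auto
  qed
  ultimately show thesis using e that by blast
qed

text \<open>If j edges between u^c and z are used, then 2 - j edges join u^c to the center and
  exactly j outer classes are matched to vertices of \<open>A\<close>. For j = 1 the center and an
  outer vertex form the required edge, for j = 2 two outer vertices do; j = 0 gives the first
  alternative.\<close>

lemma dense_gadget:
  assumes A: "A \<in> nonneg"
  shows "(sum xw {x \<in> M. dense_gadget_of x = Some A} = 2 * pot w (induced G A) (c A) \<and>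
      (\<forall>X v. DenseVU A X v \<notin> M)) \<or>
    (\<exists>e\<in>edges G. sum xw {x \<in> M. dense_gadget_of x = Some A} = w e \<and>
      (\<forall>K\<in>Kp2s p G. verts K = A \<longrightarrow> e \<in> edges K) \<and>
      (\<forall>X v. DenseVU A X v \<in> M \<longrightarrow> v \<in> e) \<and> (\<forall>i. CenterC A i \<in> M \<longrightarrow> c A \<in> e))"
proof -
  let ?O = "outer A" and ?C = "core (2 * p - 2) G A" and ?r = "pot w (induced G A)"
  have dense: "dense_set p G A" using A by (rule nonneg_dense)
  obtain m where m: "mates A m" using dense by (auto simp: dense_set_iff)
  have c: "c A \<in> ?C" "c A \<in> A" using center_core[OF dense] core_subset by blast+
  have finO: "finite ?O" unfolding outer_classes_eq[OF m] using mates_finite[OF m] by simp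
  have one: "card {e \<in> M. (\<exists>v\<in>X. e = DenseVU A X v) \<or> e = DenseUZ A X} = 1" if X: "X \<in> ?O" for X
  proof -
    have "DenseU A X \<in> XV" using A X by (auto simp: xverts_def)
    then have "card {e \<in> M. DenseU A X \<in> xends c e} = 1"
      using M_bounds[of "DenseU A X"] by simp
    moreover have "x \<in> {e \<in> M. DenseU A X \<in> xends c e} \<longleftrightarrow>
        x \<in> {e \<in> M. (\<exists>v\<in>X. e = DenseVU A X v) \<or> e = DenseUZ A X}" for x
      by (cases x) (auto dest: M_memD)
    then have "{e \<in> M. DenseU A X \<in> xends c e}
        = {e \<in> M. (\<exists>v\<in>X. e = DenseVU A X v) \<or> e = DenseUZ A X}" by blast
    ultimately show ?thesis by simp
  qed
  obtain Q f where Q: "Q \<subseteq> ?O" "card Q + card {X \<in> ?O. DenseUZ A X \<in> M} = card ?O"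
      "\<And>X. X \<in> Q \<Longrightarrow> f X \<in> X"
    and VU: "{e \<in> M. \<exists>X\<in>?O. \<exists>v\<in>X. e = DenseVU A X v} = (\<lambda>X. DenseVU A X (f X)) ` Q"
    using class_gadget[of ?O M "DenseVU A" "DenseUZ A"] finO one by auto
  define I where "I = {i. CenterC A i \<in> M}"
  define J where "J = {i. DenseCZ A i \<in> M}"
  have "DenseC A \<in> XV" "DenseZ A \<in> XV" using A by (auto simp: xverts_def)
  then have bounds: "card {e \<in> M. DenseC A \<in> xends c e} = 2"
    "card {e \<in> M. DenseZ A \<in> xends c e} = p - card ?C div 2"
    using M_bounds[of "DenseC A"] M_bounds[of "DenseZ A"] by simp_all
  have "x \<in> {e \<in> M. DenseC A \<in> xends c e} \<longleftrightarrow> x \<in> CenterC A ` I \<union> DenseCZ A ` J" for x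
    unfolding I_def J_def by (cases x) (auto dest: M_memD)
  then have "{e \<in> M. DenseC A \<in> xends c e} = CenterC A ` I \<union> DenseCZ A ` J" by blast
  moreover have "card (CenterC A ` I \<union> DenseCZ A ` J) = card I + card J"
    by (subst card_Un_disjoint) (auto simp: card_image inj_on_def)
  ultimately have IJ: "card I + card J = 2" using bounds(1) by simp
  have "x \<in> {e \<in> M. DenseZ A \<in> xends c e} \<longleftrightarrow> x \<in> DenseUZ A ` {X \<in> ?O. DenseUZ A X \<in> M} \<union> DenseCZ A ` J" for x
    unfolding J_def by (cases x) (auto dest: M_memD)
  then have "{e \<in> M. DenseZ A \<in> xends c e} = DenseUZ A ` {X \<in> ?O. DenseUZ A X \<in> M} \<union> DenseCZ A ` J" by blast
  moreover have "card (DenseUZ A ` {X \<in> ?O. DenseUZ A X \<in> M} \<union> DenseCZ A ` J)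
      = card {X \<in> ?O. DenseUZ A X \<in> M} + card J"
    using finO by (subst card_Un_disjoint) (auto simp: card_image inj_on_def)
  ultimately have "card {X \<in> ?O. DenseUZ A X \<in> M} + card J = p - card ?C div 2"
    using bounds(2) by simp
  \<comment> \<open>The capacity of z equals the number of outer classes, so each edge from u^c to z
    frees exactly one of them.\<close>
  moreover have "p - card ?C div 2 = card ?O" using card_outer_classes[OF m] by presburger
  ultimately have QJ: "card Q = card J" using Q(2) by linarith
  have finQ: "finite Q" using Q(1) finO finite_subset by blast
  have "sum xw {x \<in> M. dense_gadget_of x = Some A}
      = sum xw ((\<lambda>X. DenseVU A X (f X)) ` Q \<union> CenterC A ` I)"
    unfolding VU[symmetric]
  proof (rule sum.mono_neutral_right)
    show "\<forall>x\<in>{x \<in> M. dense_gadget_of x = Some A} -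
        ({e \<in> M. \<exists>X\<in>?O. \<exists>v\<in>X. e = DenseVU A X v} \<union> CenterC A ` I). xw x = 0"
    proof
      fix x assume "x \<in> {x \<in> M. dense_gadget_of x = Some A} -
        ({e \<in> M. \<exists>X\<in>?O. \<exists>v\<in>X. e = DenseVU A X v} \<union> CenterC A ` I)"
      then show "xw x = 0" unfolding I_def by (cases x) (auto dest: M_memD)
    qed
  qed (use M_finite in \<open>auto simp: I_def\<close>)
  also have "\<dots> = (\<Sum>X\<in>Q. ?r (f X)) + card I * ?r (c A)"
    using finQ by (subst sum.union_disjoint) (auto simp: sum.reindex inj_on_def)
  finally have S: "sum xw {x \<in> M. dense_gadget_of x = Some A}
      = (\<Sum>X\<in>Q. ?r (f X)) + card I * ?r (c A)" .
  have VU_mem: "Z \<in> Q \<and> v = f Z" if "DenseVU A Z v \<in> M" for Z v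
  proof -
    have "DenseVU A Z v \<in> {e \<in> M. \<exists>X\<in>?O. \<exists>v\<in>X. e = DenseVU A X v}"
      using that by (auto dest: M_memD)
    then show ?thesis unfolding VU by auto
  qed
  have fA: "f X \<in> A \<and> f X \<notin> ?C \<and> X = {f X, m (f X)}" if "X \<in> Q" for X
    using outer_class_mate[OF m, of X "f X"] that Q(1,3) by blast
  have same: "m' (f X) = m (f X)" if "X \<in> Q" "mates A m'" for X m'
    using outer_mate_eq[OF m that(2)] fA[OF that(1)] by blast
  consider "card J = 0" | "card J = 1" | "card J = 2" using IJ by linarith
  then show ?thesis
  proof cases
    case 1
    then have "Q = {}" using QJ finQ by simp
    then show ?thesis using 1 IJ S VU_mem by auto
  next
    case 2
    then obtain X where X: "Q = {X}" using QJ by (metis card_1_singletonE)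
    let ?e = "{c A, f X}"
    have ne: "c A \<noteq> f X" using fA[of X] c X by auto
    have e1: "?e \<in> edges G" using core_adj[OF m c(1)] fA[of X] ne X by blast
    have e2: "?e \<in> edges K" if K: "K \<in> Kp2s p G" "verts K = A" for K
    proof -
      obtain m' where m': "mates A m'" "K = mate_graph A m'" using K by (auto simp: Kp2s_iff)
      \<comment> \<open>Mates of core vertices lie in the core under every mating, while
        \<open>f X\<close> lies outside it.\<close>
      then have "f X \<noteq> m' (c A)" using core_mate[OF m'(1) c(1)] fA[of X] X by auto
      then show ?thesis using m' mates_edge_iff[OF m'(1)] c fA[of X] X ne by simp
    qed
    have e3: "sum xw {x \<in> M. dense_gadget_of x = Some A} = w ?e"
      using S 2 IJ X dense_pot[OF dense e1 c(2)] fA[of X] by simp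
    have e4: "v \<in> ?e" if "DenseVU A Z v \<in> M" for Z v using VU_mem[OF that] X by simp
    show ?thesis
      by (intro disjI2 bexI[of _ ?e] conjI ballI allI impI) (use e1 e2 e3 e4 in simp_all)
  next
    case 3
    then have "card Q = 2" using QJ by simp
    then obtain X Y where XY: "Q = {X, Y}" "X \<noteq> Y" by (auto simp: card_2_iff)
    let ?e = "{f X, f Y}"
    have fX: "f X \<in> A" "f Y \<in> A" "X = {f X, m (f X)}" "Y = {f Y, m (f Y)}" using fA XY by blast+
    have ne: "f X \<noteq> f Y" "f Y \<noteq> m (f X)"
      using fX XY(2) matesD(3)[OF m] by (metis insert_commute)+
    have e1: "?e \<in> edges G" using mates_adj[OF m fX(1,2) ne] .
    have e2: "?e \<in> edges K" if K: "K \<in> Kp2s p G" "verts K = A" for K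
    proof -
      obtain m' where m': "mates A m'" "K = mate_graph A m'" using K by (auto simp: Kp2s_iff)
      then have "f Y \<noteq> m' (f X)" using same[of X m'] XY ne by simp
      then show ?thesis using m' mates_edge_iff[OF m'(1)] fX ne by simp
    qed
    have e3: "sum xw {x \<in> M. dense_gadget_of x = Some A} = w ?e"
      using S 3 IJ XY dense_pot[OF dense e1 fX(1,2)] by simp
    have "I = {}" using 3 IJ by simp
    then have e5: "CenterC A i \<notin> M" for i unfolding I_def by blast
    have e4: "v \<in> ?e" if "DenseVU A Z v \<in> M" for Z v using VU_mem[OF that] XY by auto
    show ?thesis
      by (intro disjI2 bexI[of _ ?e] conjI ballI allI impI) (use e1 e2 e3 e4 e5 in simp_all)
  qed
qed

text \<open>Every problematic gadget is replaced by the edge from \<open>prob_gadget\<close>, every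
  dense one by a \<open>good\<close> edge where there is one. \<open>D\<close> collects the
  remaining dense sets, including those without a gadget.\<close>

lemma initial_cover: "\<exists>N D. partial_cover N D (sum xw M)"
proof -
  define S where "S A = sum xw {x \<in> M. dense_gadget_of x = Some A}" for A
  define good where "good A e \<longleftrightarrow> e \<in> edges G \<and> S A = w e \<and>
      (\<forall>K\<in>Kp2s p G. verts K = A \<longrightarrow> e \<in> edges K) \<and>
      (\<forall>X v. DenseVU A X v \<in> M \<longrightarrow> v \<in> e) \<and> (\<forall>i. CenterC A i \<in> M \<longrightarrow> c A \<in> e)" for A e
  define D where "D = {A. dense_set p G A \<and> (A \<in> nonneg \<longrightarrow> (\<forall>e. \<not> good A e))}"
  have "\<forall>H\<in>prob. \<exists>e. e \<in> edges H \<and> sum xw {x \<in> M. prob_gadget_of x = Some H} = w e \<and>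
      (\<forall>X v. ProbVU H X v \<in> M \<longrightarrow> v \<in> e)"
    using prob_gadget by metis
  from bchoice[OF this] obtain g where g: "\<And>H. H \<in> prob \<Longrightarrow> g H \<in> edges H"
      "\<And>H. H \<in> prob \<Longrightarrow> sum xw {x \<in> M. prob_gadget_of x = Some H} = w (g H)"
      "\<And>H X v. H \<in> prob \<Longrightarrow> ProbVU H X v \<in> M \<Longrightarrow> v \<in> g H"
    by blast
  have "\<exists>e. good A e" if "A \<in> nonneg - D" for A
    using that nonneg_dense[of A] unfolding D_def by blast
  then obtain h where h: "\<And>A. A \<in> nonneg - D \<Longrightarrow> good A (h A)" by metis
  \<comment> \<open>Without a \<open>good\<close> edge the first alternative of
    \<open>dense_gadget\<close> must hold, and the weight of the gadget is precisely the
    credit.\<close>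
  have bad: "S A = credit A \<and> (\<forall>X v. DenseVU A X v \<notin> M)" if "A \<in> nonneg \<inter> D" for A
    using dense_gadget[of A] that unfolding D_def S_def good_def credit_def
    by (auto simp: nonneg_dense_sets_def)
  have fin: "finite prob" "finite nonneg" "finite D"
    using finite_Kp2s finite_dense_sets
    by (simp_all add: problematic_Kp2s_def nonneg_dense_sets_def D_def)
  define E\<^sub>0 where "E\<^sub>0 = {e. OrigE e \<in> M}"
  have E0: "E\<^sub>0 \<subseteq> edges G" unfolding E\<^sub>0_def by (auto dest: M_memD)
  have finE0: "finite E\<^sub>0" using E0 finite_edges finite_subset by blast
  define N where "N = E\<^sub>0 \<union> g ` prob \<union> h ` (nonneg - D)"
  have gE: "g ` prob \<subseteq> edges G" using g(1) prob_Kp2s by (auto simp: Kp2s_def subgraph_def)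
  have hE: "h ` (nonneg - D) \<subseteq> edges G" using h by (auto simp: good_def)
  have N: "N \<subseteq> edges G" using E0 gE hE by (simp add: N_def)
  have "x \<in> M \<longleftrightarrow> x \<in> OrigE ` E\<^sub>0 \<union> (\<Union>H\<in>prob. {x \<in> M. prob_gadget_of x = Some H})
      \<union> (\<Union>A\<in>nonneg. {x \<in> M. dense_gadget_of x = Some A})" for x
    unfolding E\<^sub>0_def by (cases x) (auto dest: M_memD)
  then have M_eq: "M = OrigE ` E\<^sub>0 \<union> (\<Union>H\<in>prob. {x \<in> M. prob_gadget_of x = Some H})
      \<union> (\<Union>A\<in>nonneg. {x \<in> M. dense_gadget_of x = Some A})" by blast
  have none: "prob_gadget_of x = None \<or> dense_gadget_of x = None" for x :: "'a xedge"
    by (cases x) auto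
  have "sum xw M = sum xw (OrigE ` E\<^sub>0) + sum xw (\<Union>H\<in>prob. {x \<in> M. prob_gadget_of x = Some H})
      + sum xw (\<Union>A\<in>nonneg. {x \<in> M. dense_gadget_of x = Some A})"
  proof (subst M_eq, subst sum.union_disjoint)
    show "(OrigE ` E\<^sub>0 \<union> (\<Union>H\<in>prob. {x \<in> M. prob_gadget_of x = Some H})) \<inter>
        (\<Union>A\<in>nonneg. {x \<in> M. dense_gadget_of x = Some A}) = {}"
      using none by (auto, metis option.distinct(1))
    show "finite (OrigE ` E\<^sub>0 \<union> (\<Union>H\<in>prob. {x \<in> M. prob_gadget_of x = Some H}))"
      "finite (\<Union>A\<in>nonneg. {x \<in> M. dense_gadget_of x = Some A})"
      using fin M_finite finE0 by auto
    show "sum xw (OrigE ` E\<^sub>0 \<union> (\<Union>H\<in>prob. {x \<in> M. prob_gadget_of x = Some H})) +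
        sum xw (\<Union>A\<in>nonneg. {x \<in> M. dense_gadget_of x = Some A}) =
        sum xw (OrigE ` E\<^sub>0) + sum xw (\<Union>H\<in>prob. {x \<in> M. prob_gadget_of x = Some H}) +
        sum xw (\<Union>A\<in>nonneg. {x \<in> M. dense_gadget_of x = Some A})"
      using fin M_finite finE0 by (subst sum.union_disjoint) auto
  qed
  also have "sum xw (OrigE ` E\<^sub>0) = sum w E\<^sub>0" by (simp add: sum.reindex inj_on_def)
  also have "sum xw (\<Union>H\<in>prob. {x \<in> M. prob_gadget_of x = Some H}) = (\<Sum>H\<in>prob. w (g H))"
    using fin M_finite g(2) by (subst sum.UNION_disjoint) auto
  also have "sum xw (\<Union>A\<in>nonneg. {x \<in> M. dense_gadget_of x = Some A}) = (\<Sum>A\<in>nonneg. S A)"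
    unfolding S_def using fin M_finite by (subst sum.UNION_disjoint) auto
  also have "(\<Sum>A\<in>nonneg. S A) = (\<Sum>A\<in>nonneg - D. w (h A)) + (\<Sum>A\<in>nonneg \<inter> D. credit A)"
  proof -
    have "(\<Sum>A\<in>nonneg. S A) = (\<Sum>A\<in>nonneg - D. S A) + (\<Sum>A\<in>nonneg \<inter> D. S A)"
      using sum.Int_Diff[OF fin(2), of S D] by simp
    then show ?thesis using h bad by (simp add: good_def)
  qed
  \<comment> \<open>The members of \<open>D\<close> outside \<open>nonneg\<close> have negative
    center potential, hence credit 0.\<close>
  also have "(\<Sum>A\<in>nonneg \<inter> D. credit A) = sum credit D"
    using fin by (intro sum.mono_neutral_left)
      (auto simp: D_def nonneg_dense_sets_def credit_def)
  finally have "sum xw M = sum w E\<^sub>0 + (\<Sum>H\<in>prob. w (g H)) + (\<Sum>A\<in>nonneg - D. w (h A)) + sum credit D"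
    by simp
  \<comment> \<open>Different gadgets may yield the same edge; merging them cannot raise the
    weight.\<close>
  moreover have "sum w N \<le> sum w E\<^sub>0 + (\<Sum>H\<in>prob. w (g H)) + (\<Sum>A\<in>nonneg - D. w (h A))"
  proof -
    have un: "sum w (B \<union> B') \<le> sum w B + sum w B'" if "B \<subseteq> edges G" "B' \<subseteq> edges G" for B B'
    proof -
      have "finite B" "finite B'" using that finite_edges finite_subset by blast+
      then show ?thesis
        using that w_nonneg by (subst sum_Un) (auto intro!: sum_nonneg)
    qed
    have "sum w N \<le> sum w E\<^sub>0 + sum w (g ` prob) + sum w (h ` (nonneg - D))"
      unfolding N_def using un[of "E\<^sub>0 \<union> g ` prob" "h ` (nonneg - D)"] un[of E\<^sub>0 "g ` prob"] E0 gE hE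
      by simp
    moreover have "sum w (g ` prob) \<le> (\<Sum>H\<in>prob. w (g H))"
      using sum_image_le[OF fin(1), of w g] w_nonneg gE by (auto simp: image_subset_iff o_def)
    moreover have "sum w (h ` (nonneg - D)) \<le> (\<Sum>A\<in>nonneg - D. w (h A))"
      using sum_image_le[of "nonneg - D" w h] fin w_nonneg hE by (auto simp: image_subset_iff o_def)
    ultimately show ?thesis by linarith
  qed
  ultimately have weight: "sum w N + sum credit D \<le> sum xw M" by linarith
  have "partial_cover N D (sum xw M)"
    unfolding partial_cover_def
  proof (intro conjI ballI impI N weight)
    show "D \<subseteq> {A. dense_set p G A}" by (auto simp: D_def)
  next
    fix v assume v: "v \<in> verts G" "degree G v = 2 * p - 1"
    \<comment> \<open>The lower capacity 1 provides an edge of \<open>M\<close> at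
      \<open>Orig v\<close>. If it belongs to the gadget of a set in \<open>D\<close>, it is a
      center edge by \<open>bad\<close>, and v is exempt.\<close>
    have "Orig v \<in> XV" using v by (auto simp: xverts_def)
    moreover have "degree G v = 2 * p - 2 + 1" using v p3 by simp
    ultimately have "1 \<le> card {x \<in> M. Orig v \<in> xends c x}"
      using M_bounds(1)[of "Orig v"] by simp
    then obtain x where x: "x \<in> M" "Orig v \<in> xends c x"
      by (metis (mono_tags, lifting) Collect_empty_eq card.empty not_one_le_zero)
    show "v \<in> c ` D \<or> (\<exists>e\<in>N. v \<in> e)"
    proof (cases x)
      case (OrigE e)
      then show ?thesis using x unfolding N_def E\<^sub>0_def by auto
    next
      case (ProbVU H X u)
      then have "u = v" "H \<in> prob" using x by (auto dest: M_memD)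
      then have "v \<in> g H" using g(3) x ProbVU by blast
      then show ?thesis using \<open>H \<in> prob\<close> unfolding N_def by blast
    next
      case (DenseVU A X u)
      then have "u = v" "A \<in> nonneg" using x by (auto dest: M_memD)
      moreover from this have "A \<notin> D" using bad[of A] DenseVU x by blast
      ultimately show ?thesis using DenseVU x h[of A] unfolding N_def good_def by blast
    next
      case (CenterC A i)
      then have "v = c A" "A \<in> nonneg" using x by (auto dest: M_memD)
      then show ?thesis using CenterC x h[of A] unfolding N_def good_def by blast
    qed (use x in auto)
  next
    fix K assume K: "K \<in> Kp2s p G" "K \<in> prob \<or> dense_set p G (verts K) \<and> verts K \<notin> D"
    then show "edges K \<inter> N \<noteq> {}"
    proof (elim disjE)
      assume "K \<in> prob"
      then show ?thesis using g(1) unfolding N_def by blast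
    next
      assume "dense_set p G (verts K) \<and> verts K \<notin> D"
      then have "verts K \<in> nonneg - D" unfolding D_def by blast
      then show ?thesis using h[of "verts K"] K(1) unfolding N_def good_def by blast
    qed
  qed
  then show ?thesis by blast
qed

section \<open>From the initial cover to a covering co-t-matching\<close>

lemma covering_of_matching:
  "\<exists>N. Kp2_covering_co_t_matching p (2 * p - 2) G N \<and> sum w N \<le> sum xw M"
proof -
  obtain N where N: "partial_cover N {} (sum xw M)" "\<forall>K\<in>Kp2s p G. edges K \<inter> N \<noteq> {}"
    using initial_cover partial_cover_no_dense partial_cover_complete by metis
  then have "sum w N \<le> sum xw M" unfolding partial_cover_def by simp
  then show ?thesis using partial_cover_covering[OF N] by blast
qed

end

theorem theorem6:
  fixes p t :: nat and G :: "'a graph" and w :: "'a set \<Rightarrow> real"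
    and c :: "'a set \<Rightarrow> 'a" and M' :: "'a xedge set"
  assumes "p \<ge> 3" and "t = 2 * p - 2"
    and "simple_graph G"
    and "\<forall>v\<in>verts G. 1 \<le> degree G v \<and> degree G v \<le> t + 1"
    and "\<forall>e\<in>edges G. w e \<ge> 0"
    and "\<forall>H\<in>Kp2s p G. vertex_induced w H"
    and "center_choice p t w G c"
    and "min_weight_lb_matching (xgraph p t w G c) (xweight w G c) (lower p t G) (upper p t G) M'"
  shows "\<exists>N. Kp2_covering_co_t_matching p t G N \<and> sum w N \<le> sum (xweight w G c) M'"
proof -
  interpret gadget_matching p G w c M'
  proof
    show "degree G v \<le> 2 * p - 1" if "v \<in> verts G" for v
      using assms(1,2,4) that by force
    show "c A \<in> core (2 * p - 2) G A" if "dense_set p G A" for A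
      using assms(2,7) that unfolding center_choice_def is_center_def by blast
    show "lb_matching (xgraph p (2 * p - 2) w G c) (lower p (2 * p - 2) G) (upper p (2 * p - 2) G) M'"
      using assms(2,8) unfolding min_weight_lb_matching_def by simp
  qed (use assms in auto)
  show ?thesis using covering_of_matching assms(2) by simp
qed

end
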